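(* Let $\mathcal{D}\subseteq\mathbb{R}^n$ be open, convex and downward (i.e. $x\in\mathcal{D}$ and $y\leq x$ imply $y\in\mathcal{D}$). If $f\colon\mathcal{D}\to\mathcal{D}$ is a convex monotone map with a t-stable fixed point, then the period of each t-stable periodic point of $f$ divides the cyclicity $c(f)$. In particular, the period of each t-stable periodic point of $f$ is the order of a permutation on $n$ letters.
   Context: Order on $\mathbb{R}^n$: $x\leq y$ iff $x_i\leq y_i$ for all $i$. A map $f\colon\mathcal{D}\to\mathbb{R}^n$ is monotone if $x\leq y$ implies $f(x)\leq f(y)$, and convex if each coordinate function is convex. t-stability: for $v\in\mathcal{D}$ let $f'_v(y)=\lim_{\epsilon\downarrow 0}(f(v+\epsilon y)-f(v))/\epsilon$ for $y\in\mathbb{R}^n$. A fixed point $v$ of $f$ is t-stable if every orbit $\{(f'_v)^k(y)\colon k\geq 0\}$, $y\in\mathbb{R}^n$, is bounded from above with respect to $\leq$. A periodic point $\xi$ of $f$ with (minimal) period $p$ is t-stable if it is a t-stable fixed point of $f^p$. Critical graph: $\partial f(v)$ is the set of real $n\times n$ matrices $M$ with $f(x)-f(v)\geq M(x-v)$ for all $x\in\mathcal{D}$. If $v$ is a t-stable fixed point, all matrices in $\partial f(v)$ are nonnegative and stable (a matrix $P$ is stable if all its orbits $\{P^kx\colon k\ge 0\}$ are bounded). For a nonnegative $n\times n$ matrix $P$, $\mathcal{G}(P)$ is the directed graph on $\{1,\ldots,n\}$ with an arrow from $i$ to $j$ iff $p_{ij}>0$; the classes of $P$ are the equivalence classes of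 the relation "$i$ has access to $j$ and $j$ has access to $i$" (access = existence of a directed path; each node has access to itself). If $P$ is stable, a class $K$ is critical if $P_{KK}$ has spectral radius $1$; $N^c(P)$ is the union of the critical classes and $\mathcal{G}^c(P)$ is the restriction of $\mathcal{G}(P)$ to $N^c(P)$. One puts $\mathcal{G}^c(f)=\bigcup_{P\in\partial f(v)}\mathcal{G}^c(P)$ for a t-stable fixed point $v$; this does not depend on the choice of $v$. Cyclicity: the cyclicity of a strongly connected directed graph is the greatest common divisor of the lengths of its circuits; the cyclicity $c(\mathcal{G})$ of a general directed graph is the least common multiple of the cyclicities of its strongly connected components (equal to $1$ for the empty graph). Finally $c(f)=c(\mathcal{G}^c(f))$. *)

theory Defs
  imports
    "HOL-Analysis.Analysis"
    "HOL-Algebra.Sym_Groups"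
    "HOL-Algebra.Multiplicative_Group"
    "Jordan_Normal_Form.Spectral_Radius"
    "Graph_Theory.Digraph_Component"
    "Graph_Theory.Arc_Walk"
begin

no_notation Matrix.vec_index (infixl \<open>$\<close> 100)
no_notation Matrix.scalar_prod (infix \<open>\<bullet>\<close> 70)

definition downward :: "'a::ord set \<Rightarrow> bool" where
  "downward D \<longleftrightarrow> (\<forall>x\<in>D. \<forall>y. y \<le> x \<longrightarrow> y \<in> D)"

definition convex_map_on :: "(real^'n) set \<Rightarrow> (real^'n \<Rightarrow> real^'n) \<Rightarrow> bool" where
  "convex_map_on D f \<longleftrightarrow> (\<forall>i. convex_on D (\<lambda>x. f x $ i))"

text \<open>
  The order on \<^typ>\<open>real^'n\<close> is the componentwise one. A self-map of a set \<open>D\<close> is a total function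
  whose values outside \<open>D\<close> play no role: every notion below that does not mention \<open>D\<close> is only
  applied at points of the open set \<open>D\<close>.
\<close>

definition dir_deriv :: "(real^'n \<Rightarrow> real^'n) \<Rightarrow> real^'n \<Rightarrow> real^'n \<Rightarrow> real^'n" where
  "dir_deriv f v y = Lim (at_right 0) (\<lambda>\<epsilon>. (f (v + \<epsilon> *\<^sub>R y) - f v) /\<^sub>R \<epsilon>)"

definition t_stable_fixed_point :: "(real^'n) set \<Rightarrow> (real^'n \<Rightarrow> real^'n) \<Rightarrow> real^'n \<Rightarrow> bool" where
  "t_stable_fixed_point D f v \<longleftrightarrow>
     v \<in> D \<and> f v = v \<and> (\<forall>y. bdd_above (range (\<lambda>k. (dir_deriv f v ^^ k) y)))"

definition has_period :: "('a \<Rightarrow> 'a) \<Rightarrow> 'a \<Rightarrow> nat \<Rightarrow> bool" where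
  "has_period f \<xi> p \<longleftrightarrow> p > 0 \<and> (f ^^ p) \<xi> = \<xi> \<and> (\<forall>q. 0 < q \<and> q < p \<longrightarrow> (f ^^ q) \<xi> \<noteq> \<xi>)"

definition t_stable_periodic_point ::
  "(real^'n) set \<Rightarrow> (real^'n \<Rightarrow> real^'n) \<Rightarrow> real^'n \<Rightarrow> nat \<Rightarrow> bool" where
  "t_stable_periodic_point D f \<xi> p \<longleftrightarrow> has_period f \<xi> p \<and> t_stable_fixed_point D (f ^^ p) \<xi>"

definition subdifferential ::
  "(real^'n) set \<Rightarrow> (real^'n \<Rightarrow> real^'n) \<Rightarrow> real^'n \<Rightarrow> (real^'n^'n) set" where
  "subdifferential D f v = {M. \<forall>x\<in>D. M *v (x - v) \<le> f x - f v}"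

definition matrix_digraph :: "real^'n^'n \<Rightarrow> ('n, 'n \<times> 'n) pre_digraph" where
  "matrix_digraph P = \<lparr>verts = UNIV, arcs = {(i, j). P $ i $ j > 0}, tail = fst, head = snd\<rparr>"

definition access_classes :: "real^'n^'n \<Rightarrow> 'n set set" where
  "access_classes P = UNIV //
     {(i, j). i \<rightarrow>\<^sup>*\<^bsub>matrix_digraph P\<^esub> j \<and> j \<rightarrow>\<^sup>*\<^bsub>matrix_digraph P\<^esub> i}"

text \<open>
  The block \<open>P\<^sub>K\<^sub>K\<close> as a dimension-indexed matrix, with \<open>K\<close> enumerated by \<^const>\<open>from_nat_into\<close>
  (a bijection from \<open>{..<card K}\<close> to \<open>K\<close>); its spectrum does not depend on the enumeration.
\<close>

definition diagonal_block :: "real^'n^'n \<Rightarrow> 'n set \<Rightarrow> complex mat" where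
  "diagonal_block P K = Matrix.mat (card K) (card K)
     (\<lambda>(i, j). complex_of_real (P $ from_nat_into K i $ from_nat_into K j))"

definition critical_classes :: "real^'n^'n \<Rightarrow> 'n set set" where
  "critical_classes P = {K \<in> access_classes P. spectral_radius (diagonal_block P K) = 1}"

definition critical_nodes :: "real^'n^'n \<Rightarrow> 'n set" where
  "critical_nodes P = \<Union> (critical_classes P)"

definition matrix_critical_graph :: "real^'n^'n \<Rightarrow> ('n, 'n \<times> 'n) pre_digraph" where
  "matrix_critical_graph P = matrix_digraph P \<restriction> critical_nodes P"

text \<open>
  The critical graph of \<open>f\<close>, computed at the t-stable fixed point \<open>v\<close>; it is the same for all
  such \<open>v\<close>.
\<close>

definition critical_graph ::
  "(real^'n) set \<Rightarrow> (real^'n \<Rightarrow> real^'n) \<Rightarrow> real^'n \<Rightarrow> ('n, 'n \<times> 'n) pre_digraph" where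
  "critical_graph D f v =
     \<lparr>verts = (\<Union>P\<in>subdifferential D f v. verts (matrix_critical_graph P)),
      arcs = (\<Union>P\<in>subdifferential D f v. arcs (matrix_critical_graph P)),
      tail = fst, head = snd\<rparr>"

text \<open>
  Circuits are closed walks of positive length; restricting to elementary ones gives the same gcd.
  A component without circuits would get the value \<open>Gcd {} = 0\<close>. Critical graphs have no such
  component: a critical class without circuits would be a single node without a loop, whose
  block is \<open>0\<close> and has spectral radius \<open>0\<close>.
\<close>

definition cyclicity_scc :: "('a, 'b) pre_digraph \<Rightarrow> nat" where
  "cyclicity_scc H = Gcd {length c |u c. pre_digraph.awalk H u c u \<and> c \<noteq> []}"

definition cyclicity :: "('a, 'b) pre_digraph \<Rightarrow> nat" where
  "cyclicity G = Lcm (cyclicity_scc ` pre_digraph.sccs G)"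

end

theory Submission
  imports Defs
begin

text \<open>
  Let \<open>c\<close> be the cyclicity of the critical graph, \<open>\<xi>\<close> a t-stable periodic point of period \<open>p\<close> and
  \<open>d\<^sub>k = f\<^sup>k \<xi> - v\<close>. Every nonnegative power-bounded matrix \<open>A\<close> has a nonnegative idempotent \<open>E\<close>, a
  limit of Cesaro means of its powers, and the critical nodes are those with \<open>E i i > 0\<close>; at these,
  \<open>A x \<le> x\<close> forces \<open>(A x)\<^sub>i = x\<^sub>i\<close>. For \<open>P\<close> in the subdifferential at \<open>v\<close> convexity gives
  \<open>P d\<^sub>k \<le> d\<^sub>k\<^sub>+\<^sub>1\<close>, hence equality at the critical nodes, and \<open>d\<^sub>k\<close> vanishes at the nodes strictly
  downstream of them. By a variance argument an arc \<open>(i, j)\<close> of the critical graph makes the sequences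
  \<open>d\<^sub>k\<^sub>+\<^sub>1 i\<close> and \<open>d\<^sub>k j\<close> proportional, so \<open>f\<^sup>k \<xi>\<close> and \<open>f\<^sup>k\<^sup>+\<^sup>c \<xi>\<close> agree at the critical nodes.

  To pass to all nodes, linearise \<open>f\<close> along the orbit of \<open>\<xi>\<close>. The critical nodes of the resulting
  matrix on space-time are critical for \<open>f\<close>, and the inequality between \<open>f\<^sup>k\<^sup>+\<^sup>c \<xi>\<close> and \<open>f\<^sup>k \<xi>\<close>
  given by convexity propagates from them: \<open>f\<^sup>k \<xi> \<le> f\<^sup>k\<^sup>+\<^sup>c \<xi>\<close>. By periodicity this is an equality.
\<close>

section \<open>Limits of Cesaro means of a nonnegative matrix\<close>

text \<open>A subgradient bounds \<open>f\<close> only from below. Subgradients at \<open>v\<close>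
  tested along the orbit, and subgradients along the orbit tested at \<open>v\<close>, bound the
  deviations from opposite sides; hence the space-time matrix is needed already for the critical
  nodes. There a row of \<open>P\<close> may reach beyond its class, and the variance argument works
  only once those terms vanish.

  A component of the critical graph can mix arcs from different subgradients, so no single invariant
  vector governs it. Each arc therefore supplies its own positive factor, and periodicity has to
  show that the factors around a circuit multiply to 1, unless the deviation is zero.

  For the claim on permutations: the components have disjoint vertex sets and cyclicity at most
  their number of vertices, so disjoint cycles of these lengths fit into n letters. Their product
  has order c(f), and a suitable power of it has order \<open>p\<close>.\<close>

text \<open>The index set is a parameter because the theory is applied both to the nodes and to
  nodes paired with times below the variable \<open>p\<close>.\<close>

definition mat_app :: "'a set \<Rightarrow> ('a \<Rightarrow> 'a \<Rightarrow> real) \<Rightarrow> ('a \<Rightarrow> real) \<Rightarrow> 'a \<Rightarrow> real" where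
  "mat_app I A x i = (\<Sum>j\<in>I. A i j * x j)"

lemma mat_app_mono:
  assumes "\<And>j. j \<in> I \<Longrightarrow> 0 \<le> A i j" "\<And>j. j \<in> I \<Longrightarrow> x j \<le> y j"
  shows "mat_app I A x i \<le> mat_app I A y i"
  unfolding mat_app_def using assms by (intro sum_mono mult_left_mono) auto

lemma mat_app_diff: "mat_app I A (\<lambda>j. x j - y j) i = mat_app I A x i - mat_app I A y i"
  by (simp add: mat_app_def right_diff_distrib sum_subtractf)

lemma mat_app_uminus: "mat_app I A (\<lambda>j. - x j) i = - mat_app I A x i"
  by (simp add: mat_app_def sum_negf)

text \<open>\<open>E\<close> has the properties of a limit of Cesaro means of the powers of \<open>A\<close>.\<close>

locale limit_projection =
  fixes I :: "'a set" and A E :: "'a \<Rightarrow> 'a \<Rightarrow> real"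
  assumes fin: "finite I"
    and A_nonneg: "\<And>i j. i \<in> I \<Longrightarrow> j \<in> I \<Longrightarrow> 0 \<le> A i j"
    and E_nonneg: "\<And>i j. i \<in> I \<Longrightarrow> j \<in> I \<Longrightarrow> 0 \<le> E i j"
    and AE: "\<And>i j. i \<in> I \<Longrightarrow> j \<in> I \<Longrightarrow> (\<Sum>l\<in>I. A i l * E l j) = E i j"
    and EA: "\<And>i j. i \<in> I \<Longrightarrow> j \<in> I \<Longrightarrow> (\<Sum>l\<in>I. E i l * A l j) = E i j"
    and EE: "\<And>i j. i \<in> I \<Longrightarrow> j \<in> I \<Longrightarrow> (\<Sum>l\<in>I. E i l * E l j) = E i j"
    and sub_app: "\<And>x i. (\<And>i. i \<in> I \<Longrightarrow> x i \<le> mat_app I A x i) \<Longrightarrow> i \<in> I \<Longrightarrow> x i \<le> mat_app I E x i"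
    and sub_left: "\<And>w j. (\<And>j. j \<in> I \<Longrightarrow> w j \<le> (\<Sum>i\<in>I. w i * A i j)) \<Longrightarrow> j \<in> I \<Longrightarrow> w j \<le> (\<Sum>i\<in>I. w i * E i j)"
    and E_path: "\<And>i j. i \<in> I \<Longrightarrow> j \<in> I \<Longrightarrow> E i j > 0 \<Longrightarrow> (i, j) \<in> {(a, b). a \<in> I \<and> b \<in> I \<and> A a b > 0}\<^sup>*"
begin

lemma E_app_A: "i \<in> I \<Longrightarrow> mat_app I E (mat_app I A x) i = mat_app I E x i"
proof -
  assume i: "i \<in> I"
  have "mat_app I E (mat_app I A x) i = (\<Sum>l\<in>I. \<Sum>j\<in>I. E i l * A l j * x j)"
    by (simp add: mat_app_def sum_distrib_left mult.assoc)
  also have "\<dots> = (\<Sum>j\<in>I. (\<Sum>l\<in>I. E i l * A l j) * x j)"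
    by (subst sum.swap) (simp add: sum_distrib_right)
  also have "\<dots> = mat_app I E x i" using EA[OF i] by (simp add: mat_app_def)
  finally show ?thesis .
qed

lemma E_app_E: "i \<in> I \<Longrightarrow> mat_app I E (mat_app I E x) i = mat_app I E x i"
proof -
  assume i: "i \<in> I"
  have "mat_app I E (mat_app I E x) i = (\<Sum>l\<in>I. \<Sum>j\<in>I. E i l * E l j * x j)"
    by (simp add: mat_app_def sum_distrib_left mult.assoc)
  also have "\<dots> = (\<Sum>j\<in>I. (\<Sum>l\<in>I. E i l * E l j) * x j)"
    by (subst sum.swap) (simp add: sum_distrib_right)
  also have "\<dots> = mat_app I E x i" using EE[OF i] by (simp add: mat_app_def)
  finally show ?thesis .
qed

lemma sum_pos_obtain:
  fixes g h :: "'a \<Rightarrow> real"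
  assumes "(\<Sum>l\<in>I. g l * h l) > 0" "\<And>l. l \<in> I \<Longrightarrow> g l \<ge> 0" "\<And>l. l \<in> I \<Longrightarrow> h l \<ge> 0"
  obtains l where "l \<in> I" "g l > 0" "h l > 0"
proof -
  have "\<exists>l\<in>I. g l * h l > 0"
    using assms(1) by (meson not_le sum_nonpos)
  then obtain l where "l \<in> I" "g l * h l > 0" by blast
  with assms that show ?thesis by (metis less_eq_real_def mult_zero_left mult_zero_right less_irrefl)
qed

lemma sum_posI:
  fixes g h :: "'a \<Rightarrow> real"
  assumes "\<And>l. l \<in> I \<Longrightarrow> g l \<ge> 0" "\<And>l. l \<in> I \<Longrightarrow> h l \<ge> 0" "l \<in> I" "g l > 0" "h l > 0"
  shows "(\<Sum>l\<in>I. g l * h l) > 0"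
  using fin assms by (intro sum_pos2[of I l]) auto

lemma E_trans: "i \<in> I \<Longrightarrow> j \<in> I \<Longrightarrow> k \<in> I \<Longrightarrow> E i j > 0 \<Longrightarrow> E j k > 0 \<Longrightarrow> E i k > 0"
  using sum_posI[of "E i" "\<lambda>l. E l k" j] EE E_nonneg by auto

lemma A_E_pos: "i \<in> I \<Longrightarrow> j \<in> I \<Longrightarrow> k \<in> I \<Longrightarrow> A i j > 0 \<Longrightarrow> E j k > 0 \<Longrightarrow> E i k > 0"
  using sum_posI[of "A i" "\<lambda>l. E l k" j] AE E_nonneg A_nonneg by auto

lemma E_A_pos: "i \<in> I \<Longrightarrow> j \<in> I \<Longrightarrow> k \<in> I \<Longrightarrow> E i j > 0 \<Longrightarrow> A j k > 0 \<Longrightarrow> E i k > 0"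
  using sum_posI[of "E i" "\<lambda>l. A l k" j] EA E_nonneg A_nonneg by auto

lemma path_E_pos:
  "(i, j) \<in> {(a, b). a \<in> I \<and> b \<in> I \<and> A a b > 0}\<^sup>* \<Longrightarrow> k \<in> I \<Longrightarrow> E j k > 0 \<Longrightarrow> E i k > 0"
  by (induction rule: converse_rtrancl_induct) (auto intro: A_E_pos)

lemma E_path_pos:
  "(i, j) \<in> {(a, b). a \<in> I \<and> b \<in> I \<and> A a b > 0}\<^sup>* \<Longrightarrow> k \<in> I \<Longrightarrow> E k i > 0 \<Longrightarrow> E k j > 0"
  by (induction rule: rtrancl_induct) (auto intro: E_A_pos)

text \<open>The defect \<open>s\<close> is nonnegative and \<open>E\<close> annihilates it at
  \<open>i\<close>, since \<open>E A = E\<close>; every term \<open>E i j * s j\<close> is then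
  zero, and \<open>E i i > 0\<close> singles out \<open>s i\<close>. The identity
  \<open>E E = E\<close> treats \<open>t\<close> in the same way.\<close>

lemma critical_eq:
  assumes "\<And>i. i \<in> I \<Longrightarrow> x i \<le> mat_app I A x i" and i: "i \<in> I" "E i i > 0"
  shows "mat_app I A x i = x i" "mat_app I E x i = x i"
proof -
  define s where "s j = mat_app I A x j - x j" for j
  have s: "s j \<ge> 0" if "j \<in> I" for j using assms(1)[OF that] by (simp add: s_def)
  have "mat_app I E s i = 0"
    unfolding s_def mat_app_diff using E_app_A[OF i(1)] by simp
  then have "E i i * s i = 0"
    unfolding mat_app_def using fin i s E_nonneg by (subst (asm) sum_nonneg_eq_0_iff) auto
  with i show "mat_app I A x i = x i" by (simp add: s_def)
  define t where "t j = mat_app I E x j - x j" for j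
  have t: "t j \<ge> 0" if "j \<in> I" for j using sub_app[OF assms(1) that] by (simp add: t_def)
  have "mat_app I E t i = 0"
    unfolding t_def mat_app_diff using E_app_E[OF i(1)] by simp
  then have "E i i * t i = 0"
    unfolding mat_app_def using fin i t E_nonneg by (subst (asm) sum_nonneg_eq_0_iff) auto
  with i show "mat_app I E x i = x i" by (simp add: t_def)
qed

lemma critical_eq':
  assumes "\<And>i. i \<in> I \<Longrightarrow> mat_app I A x i \<le> x i" and i: "i \<in> I" "E i i > 0"
  shows "mat_app I A x i = x i" "mat_app I E x i = x i"
  using critical_eq[of "\<lambda>j. - x j" i] assms by (auto simp: mat_app_uminus)

text \<open>Otherwise \<open>E a b > 0\<close> would be a dense strict order on a finite nonempty set.\<close>

lemma critical_between:
  assumes ij: "i \<in> I" "j \<in> I" "E i j > 0"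
  shows "\<exists>r\<in>I. E i r > 0 \<and> E r r > 0 \<and> E r j > 0"
proof (rule ccontr)
  assume no: "\<not> ?thesis"
  define M where "M = {r\<in>I. E i r > 0 \<and> E r j > 0}"
  define R where "R = {(a, b). a \<in> M \<and> b \<in> M \<and> E a b > 0}"
  have M: "M \<subseteq> I" "finite M" using fin by (auto simp: M_def)
  have dense: "\<exists>c\<in>M. E a c > 0" if "a \<in> M" for a
  proof -
    have a: "a \<in> I" "E a j > 0" "E i a > 0" using that by (auto simp: M_def)
    have "(\<Sum>l\<in>I. E a l * E l j) > 0" using EE a ij by auto
    then obtain l where l: "l \<in> I" "E a l > 0" "E l j > 0"
      using sum_pos_obtain[of "E a" "\<lambda>l. E l j"] E_nonneg a ij by metis
    then have "l \<in> M" using E_trans[of i a l] a ij by (auto simp: M_def)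
    with l show ?thesis by auto
  qed
  have ne: "M \<noteq> {}"
  proof -
    have "(\<Sum>l\<in>I. E i l * E l j) > 0" using EE ij by auto
    then obtain l where l: "l \<in> I" "E i l > 0" "E l j > 0"
      using sum_pos_obtain[of "E i" "\<lambda>l. E l j"] E_nonneg ij by metis
    then show ?thesis by (auto simp: M_def)
  qed
  have tr: "trans R" unfolding trans_def R_def using E_trans M(1) by blast
  have "irrefl R" unfolding irrefl_def R_def using no by (auto simp: M_def)
  then have "acyclic R" using tr by (metis acyclic_irrefl trancl_id)
  moreover have "finite R" by (rule finite_subset[of _ "M \<times> M"]) (use M in \<open>auto simp: R_def\<close>)
  ultimately have "wf (R\<inverse>)" by (intro finite_acyclic_wf_converse)
  then obtain z where z: "z \<in> M" "\<And>y. (y, z) \<in> R\<inverse> \<Longrightarrow> y \<notin> M"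
    using ne by (metis all_not_in_conv wfE_min)
  obtain c where c: "c \<in> M" "E z c > 0" using dense[OF z(1)] by blast
  then have "(c, z) \<in> R\<inverse>" using z(1) unfolding R_def by blast
  then show False using z(2) c(1) by blast
qed

text \<open>\<open>y\<close> is column \<open>l\<close> of \<open>E\<close> cut down to the nodes
  that \<open>l\<close> reaches, a set closed under arcs, so the cut keeps it sub-invariant. If
  \<open>E l i = 0\<close>, then \<open>y i = 0\<close>, whereas \<open>mat_app I E y i\<close>
  contains the term \<open>E i l * E l l > 0\<close>; this contradicts
  \<open>critical_eq\<close>.\<close>

lemma critical_link_symmetric:
  assumes il: "i \<in> I" "l \<in> I" "E i i > 0" "E l l > 0" "E i l > 0"
  shows "E l i > 0"
proof (rule ccontr)
  assume "\<not> E l i > 0"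
  then have li: "E l i = 0" using E_nonneg[of l i] il by auto
  define y where "y k = (if E l k > 0 then E k l else 0)" for k
  have le: "y k \<le> mat_app I A y k" if k: "k \<in> I" for k
  proof (cases "E l k > 0")
    case True
    have "(\<Sum>j\<in>I. A k j * E j l) = mat_app I A y k" unfolding mat_app_def
    proof (rule sum.cong)
      fix j assume j: "j \<in> I"
      have "E l j > 0" if "A k j \<noteq> 0"
        using E_A_pos[OF il(2) k j True] A_nonneg[OF k j] that by auto
      then show "A k j * E j l = A k j * y j" by (auto simp: y_def)
    qed simp
    then show ?thesis using AE[OF k il(2)] True by (simp add: y_def)
  next
    case False
    have "0 \<le> mat_app I A y k"
      unfolding mat_app_def using A_nonneg k E_nonneg il by (intro sum_nonneg mult_nonneg_nonneg) (auto simp: y_def)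
    with False show ?thesis by (simp add: y_def)
  qed
  have "mat_app I E y i = y i" using critical_eq(2)[OF le] il by auto
  also have "y i = 0" using li by (simp add: y_def)
  finally have "mat_app I E y i = 0" .
  moreover have "mat_app I E y i > 0"
    unfolding mat_app_def using il E_nonneg by (intro sum_posI[of _ _ l]) (auto simp: y_def)
  ultimately show False by simp
qed

text \<open>A positive entry in row \<open>l\<close> would put a critical node \<open>r\<close>
  downstream of \<open>l\<close>. As \<open>i\<close> is critical and reaches \<open>r\<close>,
  \<open>critical_link_symmetric\<close> leads back from \<open>r\<close> to \<open>i\<close>, so
  \<open>l\<close> would reach \<open>i\<close>.\<close>

lemma downstream_row_zero:
  assumes "i \<in> I" "l \<in> I" "E i i > 0" "E i l > 0" "\<not> E l i > 0" "q \<in> I"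
  shows "E l q = 0"
proof (rule ccontr)
  assume "E l q \<noteq> 0"
  then have "E l q > 0" using E_nonneg assms by (metis order_less_le)
  then obtain r where r: "r \<in> I" "E l r > 0" "E r r > 0" using critical_between assms by blast
  then have "E i r > 0" using E_trans assms by blast
  then have "E r i > 0" using critical_link_symmetric r assms by blast
  then show False using E_trans[of l r i] r assms by blast
qed

lemma downstream_nonneg:
  assumes "i \<in> I" "l \<in> I" "E i i > 0" "E i l > 0" "\<not> E l i > 0"
    and "\<And>i. i \<in> I \<Longrightarrow> mat_app I A x i \<le> x i"
  shows "x l \<ge> 0"
proof -
  have "- x l \<le> mat_app I E (\<lambda>j. - x j) l"
    using assms(6) by (intro sub_app assms) (simp_all add: mat_app_uminus)
  also have "\<dots> = 0" unfolding mat_app_def using downstream_row_zero[OF assms(1-5)] by simp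
  finally show ?thesis by simp
qed

text \<open>A criticality test that needs no knowledge of \<open>E\<close>: \<open>u\<close> forces
  a critical node downstream of \<open>i\<close>, \<open>w\<close> one upstream of it, and
  \<open>critical_link_symmetric\<close> closes these into a loop through \<open>i\<close>.\<close>

lemma certificate_critical:
  assumes u: "\<And>i. i \<in> I \<Longrightarrow> 0 \<le> u i" "\<And>i. i \<in> I \<Longrightarrow> u i \<le> mat_app I A u i"
    and w: "\<And>i. i \<in> I \<Longrightarrow> 0 \<le> w i" "\<And>j. j \<in> I \<Longrightarrow> w j \<le> (\<Sum>i\<in>I. w i * A i j)"
    and i: "i \<in> I" "u i > 0" "w i > 0"
  shows "E i i > 0"
proof -
  have "u i \<le> mat_app I E u i" using sub_app[OF u(2) i(1)] .
  then have "(\<Sum>l\<in>I. E i l * u l) > 0" using i by (simp add: mat_app_def)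
  then obtain q where q: "q \<in> I" "E i q > 0"
    using sum_pos_obtain[of "E i" u] E_nonneg i u by metis
  obtain r where r: "r \<in> I" "E i r > 0" "E r r > 0" using critical_between i q by blast
  have "w i \<le> (\<Sum>l\<in>I. w l * E l i)" using sub_left[OF w(2) i(1)] .
  then have "(\<Sum>l\<in>I. w l * E l i) > 0" using i by simp
  then obtain q' where q': "q' \<in> I" "E q' i > 0"
    using sum_pos_obtain[of w "\<lambda>l. E l i"] E_nonneg i w by metis
  obtain r' where r': "r' \<in> I" "E r' r' > 0" "E r' i > 0" using critical_between i q' by blast
  have "E r' r > 0" using E_trans r r' i by blast
  then have "E r r' > 0" using critical_link_symmetric r r' by blast
  then show ?thesis using E_trans r r' i by blast
qed

text \<open>Maximum principle. \<open>z = E x\<close> dominates \<open>x\<close>, agrees with it at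
  critical nodes and satisfies \<open>z = E z\<close>. On the remaining nodes
  \<open>E a b > 0\<close> is a strict order on a finite set, and induction along it propagates the
  sign.\<close>

lemma nonpos_from_critical:
  assumes x: "\<And>i. i \<in> I \<Longrightarrow> x i \<le> mat_app I A x i"
    and crit: "\<And>i. i \<in> I \<Longrightarrow> E i i > 0 \<Longrightarrow> x i \<le> 0"
    and i: "i \<in> I"
  shows "x i \<le> 0"
proof -
  define z where "z = mat_app I E x"
  have zz: "mat_app I E z j = z j" if "j \<in> I" for j using E_app_E that by (simp add: z_def)
  have zc: "z j \<le> 0" if "j \<in> I" "E j j > 0" for j
    using critical_eq(2)[OF x that] crit[OF that] by (simp add: z_def)
  define N where "N = {j\<in>I. \<not> E j j > 0}"
  define R where "R = {(b, a). a \<in> N \<and> b \<in> N \<and> E a b > 0}"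
  have "finite R" by (rule finite_subset[of _ "I \<times> I"]) (use fin in \<open>auto simp: R_def N_def\<close>)
  moreover have "trans R" unfolding trans_def R_def N_def using E_trans by blast
  moreover have "irrefl R" unfolding irrefl_def R_def by (auto simp: N_def)
  ultimately have "wf R" by (metis acyclic_irrefl trancl_id finite_acyclic_wf)
  then have "j \<in> I \<longrightarrow> z j \<le> 0" for j
  proof (induction j rule: wf_induct_rule)
    case (less j)
    show ?case
    proof (intro impI, cases "E j j > 0")
      case False
      assume j: "j \<in> I"
      have "E j k * z k \<le> 0" if k: "k \<in> I" for k
      proof (cases "E j k = 0")
        case nz: False
        then have pos: "E j k > 0" using E_nonneg[OF j k] by auto
        have "z k \<le> 0"
          using zc[OF k] less[of k] False j k pos by (auto simp: R_def N_def)
        then show ?thesis using pos by (simp add: mult_nonneg_nonpos)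
      qed simp
      then have "mat_app I E z j \<le> 0" unfolding mat_app_def by (intro sum_nonpos)
      then show "z j \<le> 0" using zz j by simp
    qed (use zc in auto)
  qed
  moreover have "x i \<le> z i" using sub_app[OF x i] by (simp add: z_def)
  ultimately show ?thesis using i by force
qed

end

section \<open>Existence of the projection, by compactness of the Cesaro means\<close>

lemma convergent_subseq_finite:
  fixes x :: "nat \<Rightarrow> 'b \<Rightarrow> real"
  assumes "finite S" "\<And>n s. s \<in> S \<Longrightarrow> \<bar>x n s\<bar> \<le> B"
  shows "\<exists>\<phi> L. strict_mono (\<phi> :: nat \<Rightarrow> nat) \<and> (\<forall>s\<in>S. (\<lambda>n. x (\<phi> n) s) \<longlonglongrightarrow> L s)"
  using assms
proof (induction S rule: finite_induct)
  case empty
  show ?case by (intro exI[of _ id]) (auto simp: strict_mono_def)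
next
  case (insert s S)
  then obtain \<phi> L where \<phi>: "strict_mono \<phi>" "\<And>s. s \<in> S \<Longrightarrow> (\<lambda>n. x (\<phi> n) s) \<longlonglongrightarrow> L s"
    by (metis insertI2)
  have "bounded (range (\<lambda>n. x (\<phi> n) s))"
    using insert.prems by (auto simp: bounded_iff intro!: exI[of _ B])
  from bounded_imp_convergent_subsequence[OF this]
  obtain l r where r: "strict_mono r" "((\<lambda>n. x (\<phi> n) s) \<circ> r) \<longlonglongrightarrow> l" by blast
  have "strict_mono (\<phi> \<circ> r)" using \<phi>(1) r(1) by (rule strict_mono_o)
  moreover have "(\<lambda>n. x ((\<phi> \<circ> r) n) t) \<longlonglongrightarrow> (L(s := l)) t" if "t \<in> insert s S" for t
    using r(2) LIMSEQ_subseq_LIMSEQ[OF \<phi>(2) r(1), of t] that insert.hyps(2)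
    by (auto simp: o_def)
  ultimately show ?case by blast
qed

primrec mat_pow :: "'a set \<Rightarrow> ('a \<Rightarrow> 'a \<Rightarrow> real) \<Rightarrow> nat \<Rightarrow> 'a \<Rightarrow> 'a \<Rightarrow> real" where
  "mat_pow I A 0 i j = of_bool (i = j)"
| "mat_pow I A (Suc k) i j = mat_app I A (\<lambda>l. mat_pow I A k l j) i"

lemma mat_pow_nonneg:
  assumes "\<And>i j. i \<in> I \<Longrightarrow> j \<in> I \<Longrightarrow> 0 \<le> A i j" "i \<in> I"
  shows "0 \<le> mat_pow I A k i j"
  using assms(2) by (induction k arbitrary: i) (auto simp: mat_app_def assms(1) intro!: sum_nonneg)

lemma mat_pow_app:
  assumes "finite I" "i \<in> I"
  shows "(\<Sum>j\<in>I. mat_pow I A k i j * x j) = (mat_app I A ^^ k) x i"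
  using assms(2)
proof (induction k arbitrary: i)
  case 0
  then show ?case using assms(1) by (simp add: of_bool_def if_distrib[of "\<lambda>t. t * _"] sum.delta cong: if_cong)
next
  case (Suc k)
  have "(\<Sum>j\<in>I. mat_pow I A (Suc k) i j * x j) = (\<Sum>j\<in>I. \<Sum>l\<in>I. A i l * (mat_pow I A k l j * x j))"
    by (simp add: mat_app_def sum_distrib_right mult.assoc)
  also have "\<dots> = (\<Sum>l\<in>I. A i l * (\<Sum>j\<in>I. mat_pow I A k l j * x j))"
    by (subst sum.swap) (simp add: sum_distrib_left)
  also have "\<dots> = (\<Sum>l\<in>I. A i l * (mat_app I A ^^ k) x l)"
    using Suc.IH by (intro sum.cong) auto
  finally show ?case
    unfolding funpow.simps o_apply mat_app_def[of I A "(mat_app I A ^^ k) x" i] .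
qed

lemma mat_pow_Suc_right:
  assumes "finite I" "i \<in> I" "j \<in> I"
  shows "mat_pow I A (Suc k) i j = (\<Sum>l\<in>I. mat_pow I A k i l * A l j)"
  using assms(2)
proof (induction k arbitrary: i)
  case 0
  have "(\<Sum>l\<in>I. A i l * of_bool (l = j)) = A i j" "(\<Sum>l\<in>I. of_bool (i = l) * A l j) = A i j"
    using assms(1,3) 0 by (simp_all add: of_bool_def if_distrib[of "\<lambda>t. t * _"] if_distrib[of "\<lambda>t. _ * t"] sum.delta sum.delta' cong: if_cong)
  then show ?case by (simp add: mat_app_def)
next
  case (Suc k)
  have "mat_pow I A (Suc (Suc k)) i j = (\<Sum>m\<in>I. A i m * (\<Sum>l\<in>I. mat_pow I A k m l * A l j))"
    unfolding mat_pow.simps(2)[of I A "Suc k"] mat_app_def using Suc.IH by (intro sum.cong) auto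
  also have "\<dots> = (\<Sum>m\<in>I. \<Sum>l\<in>I. A i m * mat_pow I A k m l * A l j)"
    by (simp add: sum_distrib_left mult.assoc)
  also have "\<dots> = (\<Sum>l\<in>I. (\<Sum>m\<in>I. A i m * mat_pow I A k m l) * A l j)"
    by (subst sum.swap) (simp add: sum_distrib_right)
  finally show ?case by (simp add: mat_app_def)
qed

lemma mat_pow_path:
  assumes nonneg: "\<And>i j. i \<in> I \<Longrightarrow> j \<in> I \<Longrightarrow> 0 \<le> A i j" and "i \<in> I" "j \<in> I" "mat_pow I A k i j > 0"
  shows "(i, j) \<in> {(a, b). a \<in> I \<and> b \<in> I \<and> A a b > 0}\<^sup>*"
  using assms(2,4)
proof (induction k arbitrary: i)
  case (Suc k)
  have "\<exists>l\<in>I. A i l * mat_pow I A k l j > 0"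
  proof (rule ccontr)
    assume "\<not> ?thesis"
    then have "(\<Sum>l\<in>I. A i l * mat_pow I A k l j) \<le> 0" by (intro sum_nonpos) (auto simp: not_less)
    then show False using Suc.prems by (simp add: mat_app_def)
  qed
  then obtain l where l: "l \<in> I" "A i l * mat_pow I A k l j > 0" by blast
  then have "A i l > 0" "mat_pow I A k l j > 0"
    using nonneg[OF Suc.prems(1) l(1)] mat_pow_nonneg[of I A l k j, OF nonneg l(1)]
    by (auto simp: zero_less_mult_iff)
  then show ?case using Suc.IH[OF l(1)] l(1) Suc.prems(1)
    by (intro converse_rtrancl_into_rtrancl[of i l]) auto
qed (auto split: if_splits)

text \<open>The row sums bound all entries of the powers, so a subsequence of the Cesaro means
  converges. \<open>AE\<close>, \<open>EA\<close> and \<open>EE\<close> alone would also admit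
  \<open>E = 0\<close>; \<open>sub_app\<close> and \<open>sub_left\<close> record that
  \<open>E\<close> is a limit of averages: \<open>x \<le> A x\<close> iterates to all powers and
  survives averaging.\<close>

theorem limit_projection_exists:
  assumes fin: "finite I"
    and nonneg: "\<And>i j. i \<in> I \<Longrightarrow> j \<in> I \<Longrightarrow> 0 \<le> A i j"
    and bound: "\<And>k i. i \<in> I \<Longrightarrow> (mat_app I A ^^ k) (\<lambda>_. 1) i \<le> B"
  shows "\<exists>E. limit_projection I A E"
proof -
  let ?P = "mat_pow I A"
  note pn = mat_pow_nonneg[of I A, OF nonneg]
  have pB: "?P k i j \<le> B" if "i \<in> I" "j \<in> I" for k i j
  proof -
    have "?P k i j \<le> (\<Sum>j\<in>I. ?P k i j * 1)"
      unfolding mult_1_right using that fin pn[OF _ _ that(1)] by (intro member_le_sum) auto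
    also have "\<dots> \<le> B" unfolding mat_pow_app[OF fin that(1)] using bound that by simp
    finally show ?thesis .
  qed
  define c where "c r i j = (\<Sum>k<Suc r. ?P k i j) / real (Suc r)" for r i j
  have cn: "0 \<le> c r i j" if "i \<in> I" for r i j
    unfolding c_def using pn that by (intro divide_nonneg_nonneg sum_nonneg) auto
  have cB: "c r i j \<le> B" if "i \<in> I" "j \<in> I" for r i j
  proof -
    have "(\<Sum>k<Suc r. ?P k i j) \<le> real (card {..<Suc r}) * B"
      using pB that by (intro sum_bounded_above) auto
    then show ?thesis unfolding c_def by (simp add: divide_le_eq mult.commute)
  qed
  obtain \<phi> L where \<phi>: "strict_mono \<phi>" "\<forall>s\<in>I \<times> I. (\<lambda>n. (\<lambda>(i, j). c (\<phi> n) i j) s) \<longlonglongrightarrow> L s"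
    using convergent_subseq_finite[of "I \<times> I" "\<lambda>r (i, j). c r i j" B] fin cn cB by fastforce
  define E where "E i j = L (i, j)" for i j
  have lim: "(\<lambda>n. c (\<phi> n) i j) \<longlonglongrightarrow> E i j" if "i \<in> I" "j \<in> I" for i j
    using \<phi>(2) that by (force simp: E_def)
  have "filterlim (\<lambda>n. real (Suc (\<phi> n))) at_top sequentially"
    using filterlim_compose[OF filterlim_real_sequentially filterlim_compose[OF filterlim_Suc filterlim_subseq[OF \<phi>(1)]]] .
  then have inv0: "(\<lambda>n. C / real (Suc (\<phi> n))) \<longlonglongrightarrow> 0" for C
    by (intro real_tendsto_divide_at_top[of _ C]) auto
  have shift: "(\<lambda>n. (\<Sum>k<Suc (\<phi> n). ?P (Suc k) i j) / real (Suc (\<phi> n))) \<longlonglongrightarrow> E i j"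
    if ij: "i \<in> I" "j \<in> I" for i j
  proof -
    \<comment> \<open>Shifting the exponents by one telescopes to a boundary term, which is bounded
      and vanishes after division.\<close>
    have eq: "(\<Sum>k<Suc r. ?P (Suc k) i j) / real (Suc r) = c r i j + (?P (Suc r) i j - ?P 0 i j) / real (Suc r)" for r
    proof -
      have "(\<Sum>k<Suc r. ?P (Suc k) i j) - (\<Sum>k<Suc r. ?P k i j) = ?P (Suc r) i j - ?P 0 i j"
        using sum_lessThan_telescope[of "\<lambda>k. ?P k i j" "Suc r"] by (simp only: sum_subtractf)
      then have "(\<Sum>k<Suc r. ?P (Suc k) i j) = (\<Sum>k<Suc r. ?P k i j) + (?P (Suc r) i j - ?P 0 i j)" by linarith
      then show ?thesis unfolding c_def by (simp only: add_divide_distrib)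
    qed
    have "(\<lambda>n. (?P (Suc (\<phi> n)) i j - ?P 0 i j) / real (Suc (\<phi> n))) \<longlonglongrightarrow> 0"
    proof (rule Lim_null_comparison[OF _ inv0[of "B + 1"]], rule always_eventually, rule allI)
      fix n
      have "\<bar>?P (Suc (\<phi> n)) i j - ?P 0 i j\<bar> \<le> B + 1"
        using pB[OF ij, of "Suc (\<phi> n)"] pB[OF ij, of 0] pn[OF _ _ ij(1), of "Suc (\<phi> n)" j]
        by (auto simp del: mat_pow.simps(2) split: if_splits)
      then show "norm ((?P (Suc (\<phi> n)) i j - ?P 0 i j) / real (Suc (\<phi> n))) \<le> (B + 1) / real (Suc (\<phi> n))"
        by (simp del: mat_pow.simps of_nat_Suc add: divide_right_mono)
    qed
    from tendsto_add[OF lim[OF ij] this] show ?thesis unfolding eq by simp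
  qed
  have E_nonneg: "0 \<le> E i j" if "i \<in> I" "j \<in> I" for i j
    by (rule LIMSEQ_le_const[OF lim[OF that]]) (use cn that in auto)
  have AE: "(\<Sum>l\<in>I. A i l * E l j) = E i j" if ij: "i \<in> I" "j \<in> I" for i j
  proof (rule LIMSEQ_unique[OF _ shift[OF ij]])
    have "(\<Sum>k<Suc r. ?P (Suc k) i j) / real (Suc r) = (\<Sum>l\<in>I. A i l * c r l j)" for r
      unfolding c_def mat_pow.simps mat_app_def
      by (subst sum.swap) (simp add: sum_distrib_left sum_divide_distrib del: sum.lessThan_Suc)
    then show "(\<lambda>n. (\<Sum>k<Suc (\<phi> n). ?P (Suc k) i j) / real (Suc (\<phi> n))) \<longlonglongrightarrow> (\<Sum>l\<in>I. A i l * E l j)"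
      using lim ij by (simp del: sum.lessThan_Suc) (intro tendsto_sum tendsto_mult, auto)
  qed
  have EA: "(\<Sum>l\<in>I. E i l * A l j) = E i j" if ij: "i \<in> I" "j \<in> I" for i j
  proof (rule LIMSEQ_unique[OF _ shift[OF ij]])
    have "(\<Sum>k<Suc r. ?P (Suc k) i j) / real (Suc r) = (\<Sum>l\<in>I. c r i l * A l j)" for r
      unfolding c_def mat_pow_Suc_right[OF fin ij]
      by (subst sum.swap) (simp add: sum_distrib_right sum_divide_distrib del: sum.lessThan_Suc)
    then show "(\<lambda>n. (\<Sum>k<Suc (\<phi> n). ?P (Suc k) i j) / real (Suc (\<phi> n))) \<longlonglongrightarrow> (\<Sum>l\<in>I. E i l * A l j)"
      using lim ij by (simp del: sum.lessThan_Suc mat_pow.simps) (intro tendsto_sum tendsto_mult, auto)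
  qed
  have avg_const: "(\<Sum>k<Suc r. x) / real (Suc r) = x" for r and x :: real by simp
  have cEeq: "(\<Sum>l\<in>I. c r i l * x l) = (\<Sum>k<Suc r. (mat_app I A ^^ k) x i) / real (Suc r)" if "i \<in> I" for r i x
  proof -
    have "(\<Sum>l\<in>I. c r i l * x l) = (\<Sum>k<Suc r. (\<Sum>l\<in>I. ?P k i l * x l)) / real (Suc r)"
      unfolding c_def
      by (subst sum.swap) (simp add: sum_distrib_right sum_divide_distrib del: sum.lessThan_Suc)
    then show ?thesis using mat_pow_app[OF fin that] by simp
  qed
  have EE: "(\<Sum>l\<in>I. E i l * E l j) = E i j" if ij: "i \<in> I" "j \<in> I" for i j
  proof (rule LIMSEQ_unique)
    show "(\<lambda>n. (\<Sum>l\<in>I. c (\<phi> n) i l * E l j)) \<longlonglongrightarrow> (\<Sum>l\<in>I. E i l * E l j)"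
      using lim ij by (intro tendsto_sum tendsto_mult) auto
    have "(mat_app I A ^^ k) (\<lambda>l. E l j) i = E i j" if "i \<in> I" for k i
      using that
    proof (induction k arbitrary: i)
      case (Suc k)
      have "(mat_app I A ^^ Suc k) (\<lambda>l. E l j) i = (\<Sum>l\<in>I. A i l * E l j)"
        unfolding funpow.simps o_apply mat_app_def[of I A "(mat_app I A ^^ k) (\<lambda>l. E l j)" i]
        using Suc.IH by (intro sum.cong) auto
      then show ?case using AE Suc.prems ij by simp
    qed simp
    then have "(\<Sum>l\<in>I. c r i l * E l j) = E i j" for r
      unfolding cEeq[OF ij(1)] using ij avg_const by simp
    then show "(\<lambda>n. (\<Sum>l\<in>I. c (\<phi> n) i l * E l j)) \<longlonglongrightarrow> E i j" by simp
  qed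
  have sub_app: "x i \<le> mat_app I E x i" if x: "\<And>i. i \<in> I \<Longrightarrow> x i \<le> mat_app I A x i" and i: "i \<in> I" for x i
  proof (rule LIMSEQ_le_const)
    show "(\<lambda>n. (\<Sum>l\<in>I. c (\<phi> n) i l * x l)) \<longlonglongrightarrow> mat_app I E x i"
      unfolding mat_app_def using lim i by (intro tendsto_sum tendsto_mult) auto
    have "x i \<le> (mat_app I A ^^ k) x i" if "i \<in> I" for k i
      using that
    proof (induction k arbitrary: i)
      case (Suc k)
      have "x i \<le> mat_app I A x i" using x Suc.prems .
      also have "\<dots> \<le> mat_app I A ((mat_app I A ^^ k) x) i"
        using Suc nonneg by (intro mat_app_mono) auto
      finally show ?case by simp
    qed simp
    then have "(\<Sum>k<Suc r. x i) \<le> (\<Sum>k<Suc r. (mat_app I A ^^ k) x i)" for r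
      using i by (intro sum_mono) auto
    then have "x i \<le> (\<Sum>l\<in>I. c r i l * x l)" for r
      unfolding cEeq[OF i] using divide_right_mono[of "\<Sum>k<Suc r. x i" _ "real (Suc r)"] avg_const[of "x i" r]
      by (metis of_nat_0_le_iff)
    then show "\<exists>N. \<forall>n\<ge>N. x i \<le> (\<Sum>l\<in>I. c (\<phi> n) i l * x l)" by blast
  qed
  have sub_left: "w j \<le> (\<Sum>i\<in>I. w i * E i j)"
    if w: "\<And>j. j \<in> I \<Longrightarrow> w j \<le> (\<Sum>i\<in>I. w i * A i j)" and j: "j \<in> I" for w j
  proof (rule LIMSEQ_le_const)
    show "(\<lambda>n. (\<Sum>i\<in>I. w i * c (\<phi> n) i j)) \<longlonglongrightarrow> (\<Sum>i\<in>I. w i * E i j)"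
      using lim j by (intro tendsto_sum tendsto_mult) auto
    have wk: "w j \<le> (\<Sum>i\<in>I. w i * ?P k i j)" if "j \<in> I" for k j
      using that
    proof (induction k arbitrary: j)
      case 0
      then show ?case using fin by (simp add: of_bool_def if_distrib[of "\<lambda>t. _ * t"] sum.delta' cong: if_cong)
    next
      case (Suc k)
      have "w j \<le> (\<Sum>l\<in>I. w l * A l j)" using w Suc.prems .
      also have "\<dots> \<le> (\<Sum>l\<in>I. (\<Sum>i\<in>I. w i * ?P k i l) * A l j)"
        using Suc nonneg by (intro sum_mono mult_right_mono) auto
      also have "\<dots> = (\<Sum>i\<in>I. \<Sum>l\<in>I. w i * (?P k i l * A l j))"
        by (subst sum.swap) (simp add: sum_distrib_right mult.assoc)
      also have "\<dots> = (\<Sum>i\<in>I. w i * ?P (Suc k) i j)"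
        using mat_pow_Suc_right[OF fin _ Suc.prems] by (intro sum.cong) (auto simp: sum_distrib_left[symmetric])
      finally show ?case .
    qed
    have "(\<Sum>k<Suc r. w j) \<le> (\<Sum>k<Suc r. \<Sum>i\<in>I. w i * ?P k i j)" for r
      using wk[OF j] by (intro sum_mono) auto
    moreover have "(\<Sum>i\<in>I. w i * c r i j) = (\<Sum>k<Suc r. \<Sum>i\<in>I. w i * ?P k i j) / real (Suc r)" for r
      unfolding c_def
      by (subst sum.swap) (simp add: sum_distrib_left sum_divide_distrib del: sum.lessThan_Suc)
    ultimately have "w j \<le> (\<Sum>i\<in>I. w i * c r i j)" for r
      using divide_right_mono[of "\<Sum>k<Suc r. w j" _ "real (Suc r)"] avg_const[of "w j" r]
      by (metis of_nat_0_le_iff)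
    then show "\<exists>N. \<forall>n\<ge>N. w j \<le> (\<Sum>i\<in>I. w i * c (\<phi> n) i j)" by blast
  qed
  have E_path: "(i, j) \<in> {(a, b). a \<in> I \<and> b \<in> I \<and> A a b > 0}\<^sup>*" if ij: "i \<in> I" "j \<in> I" "E i j > 0" for i j
  proof (rule ccontr)
    assume "\<not> ?thesis"
    then have "?P k i j = 0" for k
      using mat_pow_path[of I A i j k, OF nonneg ij(1,2)] pn[OF _ _ ij(1), of k j] by force
    then have "c r i j = 0" for r by (simp add: c_def)
    then have "E i j = 0" using lim[OF ij(1,2)] by (simp add: LIMSEQ_const_iff)
    with ij show False by simp
  qed
  have "limit_projection I A E"
    by unfold_locales (fact fin nonneg E_nonneg AE EA EE sub_app sub_left E_path)+
  then show ?thesis by blast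
qed

section \<open>Subdifferentials of convex monotone maps\<close>

lemma vec_le_iff: "(x :: real^'n) \<le> y \<longleftrightarrow> (\<forall>i. x $ i \<le> y $ i)"
  by (rule Finite_Cartesian_Product.less_eq_vec_def)

text \<open>Separate the epigraph from the open half-line below \<open>(a, h a)\<close>. Openness of
  \<open>D\<close> rules out a vertical hyperplane, and dividing its normal by \<open>-q\<close>
  gives the slope.\<close>

lemma convex_subgradient_exists:
  fixes h :: "'a::euclidean_space \<Rightarrow> real"
  assumes D: "open D" "convex_on D h" and a: "a \<in> D"
  shows "\<exists>r. \<forall>x\<in>D. r \<bullet> (x - a) \<le> h x - h a"
proof -
  let ?T = "{a} \<times> {..<h a}"
  have "convex (epigraph D h)" using D(2) by (rule convex_epigraphI)
  moreover have "convex ?T" by (intro convex_Times) auto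
  moreover have "(a, h a) \<in> epigraph D h" "(a, h a - 1) \<in> ?T" using a by (auto simp: epigraph_def)
  moreover have "epigraph D h \<inter> ?T = {}" by (auto simp: epigraph_def)
  ultimately obtain w b where w: "w \<noteq> 0" "\<And>z. z \<in> epigraph D h \<Longrightarrow> w \<bullet> z \<le> b" "\<And>z. z \<in> ?T \<Longrightarrow> w \<bullet> z \<ge> b"
    using separating_hyperplane_sets[of "epigraph D h" ?T] by blast
  obtain p q where pq: "w = (p, q)" by (cases w)
  have up: "p \<bullet> x + q * t \<le> b" if "x \<in> D" "h x \<le> t" for x t
    using w(2)[of "(x, t)"] that by (simp add: pq epigraph_def)
  have lo: "p \<bullet> a + q * t \<ge> b" if "t < h a" for t
    using w(3)[of "(a, t)"] that by (simp add: pq)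
  have q0: "q \<le> 0" using up[OF a, of "h a"] lo[of "h a - 1"] by (simp add: algebra_simps)
  have ba: "p \<bullet> a + q * h a \<ge> b"
  proof (rule field_le_epsilon)
    fix e :: real assume e: "e > 0"
    \<comment> \<open>The denominator \<open>1 - q\<close> keeps \<open>- q * d \<le> e\<close>
      valid also for \<open>q = 0\<close>, which is not yet excluded.\<close>
    define d where "d = e / (1 - q)"
    have d: "d > 0" using e q0 by (simp add: d_def)
    have "- q * d \<le> e" using e q0 by (simp add: d_def field_simps)
    with lo[of "h a - d"] d show "b \<le> p \<bullet> a + q * h a + e" by (simp add: algebra_simps)
  qed
  have "q \<noteq> 0"
  proof
    assume q: "q = 0"
    with w(1) pq have p: "p \<noteq> 0" by (auto simp: zero_prod_def)
    obtain e where e: "e > 0" "ball a e \<subseteq> D" using D(1) a openE by blast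
    \<comment> \<open>A step of length \<open>e / 2\<close> in direction \<open>p\<close> stays in
      \<open>D\<close> and would push \<open>p \<bullet> x\<close> above
      \<open>p \<bullet> a\<close>.\<close>
    define x where "x = a + (e / (2 * norm p)) *\<^sub>R p"
    have "x \<in> ball a e" using e p by (simp add: x_def dist_norm)
    then have "p \<bullet> x \<le> p \<bullet> a" using e up[of x "h x"] ba q by auto
    moreover have "p \<bullet> x = p \<bullet> a + (e / (2 * norm p)) * (p \<bullet> p)" by (simp add: x_def inner_add_right)
    moreover have "(e / (2 * norm p)) * (p \<bullet> p) > 0" using e p by (intro mult_pos_pos divide_pos_pos) auto
    ultimately show False by linarith
  qed
  with q0 have q: "q < 0" by simp
  have "((1 / (- q)) *\<^sub>R p) \<bullet> (x - a) \<le> h x - h a" if "x \<in> D" for x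
    using up[OF that order_refl] ba q by (simp add: inner_diff_right field_simps)
  then show ?thesis by blast
qed

lemma mono_bounded_below_tendsto_at_right:
  fixes q :: "real \<Rightarrow> real"
  assumes d: "d > 0" and mono: "\<And>s t. 0 < s \<Longrightarrow> s \<le> t \<Longrightarrow> t < d \<Longrightarrow> q s \<le> q t"
    and bd: "\<And>t. 0 < t \<Longrightarrow> t < d \<Longrightarrow> m \<le> q t"
  shows "\<exists>L. (q \<longlongrightarrow> L) (at_right 0)"
proof -
  define L where "L = Inf (q ` {0<..<d})"
  have bdd: "bdd_below (q ` {0<..<d})" using bd by (auto intro!: bdd_belowI[of _ m])
  have "(q \<longlongrightarrow> L) (at_right 0)"
  proof (rule order_tendstoI)
    fix c assume c: "c < L"
    have "c < q t" if "0 < t" "t < d" for t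
      using cInf_lower[OF _ bdd, of "q t"] that c by (auto simp: L_def)
    then show "\<forall>\<^sub>F t in at_right 0. c < q t"
      using eventually_at_right_real[OF d] by (auto elim: eventually_mono)
  next
    fix c assume c: "L < c"
    then obtain t where t: "0 < t" "t < d" "q t < c"
      using cInf_lessD[of "q ` {0<..<d}" c] d by (auto simp: L_def)
    then have "q s < c" if "0 < s" "s < t" for s using mono[of s t] that by auto
    then show "\<forall>\<^sub>F t in at_right 0. q t < c"
      using eventually_at_right_real[OF t(1)] by (auto elim: eventually_mono)
  qed
  then show ?thesis by blast
qed

text \<open>Being a subgradient is a condition on each row separately. Rows of different
  subgradients may thus be mixed into one matrix, or averaged, as the later constructions of
  \<open>Q\<close> and \<open>P\<close> do.\<close>

definition row_subgradient :: "(real^'n) set \<Rightarrow> (real^'n \<Rightarrow> real^'n) \<Rightarrow> real^'n \<Rightarrow> 'n \<Rightarrow> real^'n \<Rightarrow> bool" where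
  "row_subgradient D f v i r \<longleftrightarrow> (\<forall>x\<in>D. r \<bullet> (x - v) \<le> f x $ i - f v $ i)"

lemma subdifferential_iff_rows: "M \<in> subdifferential D f v \<longleftrightarrow> (\<forall>i. row_subgradient D f v i (M $ i))"
  unfolding subdifferential_def row_subgradient_def vec_le_iff mem_Collect_eq
  by (auto simp: matrix_vector_mul_component)

lemma subdifferential_nonempty:
  assumes "open D" "convex_map_on D f" "v \<in> D"
  shows "\<exists>M. M \<in> subdifferential D f v"
proof -
  have "\<exists>r. row_subgradient D f v i r" for i
    using convex_subgradient_exists[of D "\<lambda>x. f x $ i" v] assms
    by (auto simp: convex_map_on_def row_subgradient_def)
  then obtain r where "\<And>i. row_subgradient D f v i (r i)" by metis
  then have "(\<chi> i. r i) \<in> subdifferential D f v" by (simp add: subdifferential_iff_rows)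
  then show ?thesis by blast
qed

text \<open>Test the subgradient at \<open>v - axis j 1\<close>, which lies in \<open>D\<close>
  because \<open>D\<close> is downward; there \<open>f\<close> is no larger than at
  \<open>v\<close>.\<close>

lemma subdifferential_nonneg:
  fixes f :: "real^'n \<Rightarrow> real^'n"
  assumes "downward D" "mono_on D f" "v \<in> D" and M: "M \<in> subdifferential D f v"
  shows "0 \<le> M $ i $ j"
proof -
  let ?x = "v - axis j 1"
  have le: "?x \<le> v" by (auto simp: vec_le_iff axis_def)
  then have x: "?x \<in> D" using assms(1,3) unfolding downward_def by blast
  have "M $ i \<bullet> (?x - v) \<le> f ?x $ i - f v $ i"
    using M x unfolding subdifferential_iff_rows row_subgradient_def by blast
  also have "\<dots> \<le> 0" using mono_onD[OF assms(2) x assms(3) le] by (simp add: vec_le_iff)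
  also have "M $ i \<bullet> (?x - v) = - M $ i $ j" by (simp add: inner_axis)
  finally show ?thesis by simp
qed

text \<open>Makes the \<open>Lim\<close> in \<open>dir_deriv\<close> an actual limit: by convexity
  each coordinate of the difference quotient is monotone in \<open>\<epsilon>\<close>, and a
  subgradient bounds it from below.\<close>

lemma dir_deriv_tendsto:
  fixes f :: "real^'n \<Rightarrow> real^'n"
  assumes D: "open D" "convex_map_on D f" "v \<in> D"
  shows "((\<lambda>\<epsilon>. (f (v + \<epsilon> *\<^sub>R y) - f v) /\<^sub>R \<epsilon>) \<longlongrightarrow> dir_deriv f v y) (at_right 0)"
proof -
  obtain M where M: "M \<in> subdifferential D f v" using subdifferential_nonempty[OF D] by blast
  obtain d where d: "d > 0" "\<And>t. 0 < t \<Longrightarrow> t < d \<Longrightarrow> v + t *\<^sub>R y \<in> D"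
  proof -
    obtain e where e: "e > 0" "ball v e \<subseteq> D" using D openE by blast
    show ?thesis
    proof (rule that[of "e / (norm y + 1)"])
      show "e / (norm y + 1) > 0" using e by (simp add: add_nonneg_pos)
      fix t assume t: "0 < t" "t < e / (norm y + 1)"
      have "t * norm y \<le> t * (norm y + 1)" using t by simp
      also have "\<dots> < e" using t by (simp add: pos_less_divide_eq add_nonneg_pos)
      finally have "v + t *\<^sub>R y \<in> ball v e" using t by (simp add: dist_norm)
      then show "v + t *\<^sub>R y \<in> D" using e by blast
    qed
  qed
  have "\<exists>L. ((\<lambda>\<epsilon>. (f (v + \<epsilon> *\<^sub>R y) $ i - f v $ i) / \<epsilon>) \<longlongrightarrow> L) (at_right 0)" for i
  proof (rule mono_bounded_below_tendsto_at_right[OF d(1)])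
    fix s t assume st: "0 < s" "s \<le> t" "t < d"
    have cv: "convex_on D (\<lambda>x. f x $ i)" using D(2) by (simp add: convex_map_on_def)
    have eq: "v + s *\<^sub>R y = (1 - s / t) *\<^sub>R v + (s / t) *\<^sub>R (v + t *\<^sub>R y)"
      using st by (simp add: algebra_simps)
    have "f (v + s *\<^sub>R y) $ i \<le> (1 - s / t) * f v $ i + (s / t) * f (v + t *\<^sub>R y) $ i"
      unfolding eq using convex_onD[OF cv, of "s / t" v "v + t *\<^sub>R y"] st d(2)[of t] D(3) by auto
    then have "f (v + s *\<^sub>R y) $ i - f v $ i \<le> (s / t) * (f (v + t *\<^sub>R y) $ i - f v $ i)"
      by (simp add: algebra_simps)
    then have "(f (v + s *\<^sub>R y) $ i - f v $ i) / s \<le> (s / t) * (f (v + t *\<^sub>R y) $ i - f v $ i) / s"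
      using st by (intro divide_right_mono) auto
    also have "\<dots> = (f (v + t *\<^sub>R y) $ i - f v $ i) / t"
      using st by simp
    finally show "(f (v + s *\<^sub>R y) $ i - f v $ i) / s \<le> (f (v + t *\<^sub>R y) $ i - f v $ i) / t" .
  next
    fix t assume t: "0 < t" "t < d"
    have "M $ i \<bullet> (t *\<^sub>R y) \<le> f (v + t *\<^sub>R y) $ i - f v $ i"
      using M d(2)[OF t] by (force simp: subdifferential_iff_rows row_subgradient_def)
    then show "M $ i \<bullet> y \<le> (f (v + t *\<^sub>R y) $ i - f v $ i) / t" using t by (simp add: pos_le_divide_eq mult.commute)
  qed
  then have "\<forall>i. \<exists>L. ((\<lambda>\<epsilon>. (f (v + \<epsilon> *\<^sub>R y) $ i - f v $ i) / \<epsilon>) \<longlongrightarrow> L) (at_right 0)" by (rule allI)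
  from choice[OF this]
  obtain L where L: "\<And>i. ((\<lambda>\<epsilon>. (f (v + \<epsilon> *\<^sub>R y) $ i - f v $ i) / \<epsilon>) \<longlongrightarrow> L i) (at_right 0)" by blast
  have "((\<lambda>\<epsilon>. (f (v + \<epsilon> *\<^sub>R y) - f v) /\<^sub>R \<epsilon>) \<longlongrightarrow> (\<chi> i. L i)) (at_right 0)"
  proof (rule vec_tendstoI)
    fix i
    show "((\<lambda>\<epsilon>. ((f (v + \<epsilon> *\<^sub>R y) - f v) /\<^sub>R \<epsilon>) $ i) \<longlongrightarrow> (\<chi> i. L i) $ i) (at_right 0)"
      using L[of i] by (simp add: divide_inverse mult.commute)
  qed
  moreover from this have "dir_deriv f v y = (\<chi> i. L i)"
    unfolding dir_deriv_def by (intro tendsto_Lim) auto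
  ultimately show ?thesis by simp
qed

lemma eventually_in_open_right:
  fixes v y :: "'a::real_normed_vector"
  assumes "open D" "v \<in> D"
  shows "\<forall>\<^sub>F \<epsilon> in at_right (0::real). v + \<epsilon> *\<^sub>R y \<in> D"
proof -
  have "((\<lambda>\<epsilon>. v + \<epsilon> *\<^sub>R y) \<longlongrightarrow> v + 0 *\<^sub>R y) (at_right (0::real))" by (intro tendsto_intros)
  then show ?thesis using assms by (auto dest: topological_tendstoD)
qed

lemma dir_deriv_ge_subdifferential:
  fixes f :: "real^'n \<Rightarrow> real^'n"
  assumes D: "open D" "convex_map_on D f" "v \<in> D" and M: "M \<in> subdifferential D f v"
  shows "M *v y \<le> dir_deriv f v y"
  unfolding vec_le_iff
proof (rule allI)
  fix i
  have "((\<lambda>\<epsilon>. ((f (v + \<epsilon> *\<^sub>R y) - f v) /\<^sub>R \<epsilon>) $ i) \<longlongrightarrow> dir_deriv f v y $ i) (at_right 0)"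
    using dir_deriv_tendsto[OF D] by (rule tendsto_vec_nth)
  moreover have "\<forall>\<^sub>F \<epsilon> in at_right 0. (M *v y) $ i \<le> ((f (v + \<epsilon> *\<^sub>R y) - f v) /\<^sub>R \<epsilon>) $ i"
    using eventually_in_open_right[OF D(1,3), of y] eventually_at_right_less[of 0]
  proof eventually_elim
    case (elim \<epsilon>)
    have "M $ i \<bullet> (\<epsilon> *\<^sub>R y) \<le> f (v + \<epsilon> *\<^sub>R y) $ i - f v $ i"
      using M elim(1) by (force simp: subdifferential_iff_rows row_subgradient_def)
    then show ?case using elim(2) by (simp add: matrix_vector_mul_component field_simps)
  qed
  ultimately show "(M *v y) $ i \<le> dir_deriv f v y $ i"
    by (rule tendsto_lowerbound) simp
qed

lemma dir_deriv_mono: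
  fixes f :: "real^'n \<Rightarrow> real^'n"
  assumes D: "open D" "convex_map_on D f" "v \<in> D" and "mono_on D f" and yz: "y \<le> z"
  shows "dir_deriv f v y \<le> dir_deriv f v z"
  unfolding vec_le_iff
proof (rule allI)
  fix i
  have "((\<lambda>\<epsilon>. ((f (v + \<epsilon> *\<^sub>R w) - f v) /\<^sub>R \<epsilon>) $ i) \<longlongrightarrow> dir_deriv f v w $ i) (at_right 0)" for w
    using dir_deriv_tendsto[OF D] by (rule tendsto_vec_nth)
  moreover have "\<forall>\<^sub>F \<epsilon> in at_right 0. ((f (v + \<epsilon> *\<^sub>R y) - f v) /\<^sub>R \<epsilon>) $ i \<le> ((f (v + \<epsilon> *\<^sub>R z) - f v) /\<^sub>R \<epsilon>) $ i"
    using eventually_in_open_right[OF D(1,3), of y] eventually_in_open_right[OF D(1,3), of z] eventually_at_right_less[of 0]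
  proof eventually_elim
    case (elim \<epsilon>)
    have "v + \<epsilon> *\<^sub>R y \<le> v + \<epsilon> *\<^sub>R z" using elim(3) yz by (simp add: vec_le_iff)
    from mono_onD[OF assms(4) elim(1,2) this] show ?case
      using elim(3) by (simp add: vec_le_iff field_simps)
  qed
  ultimately show "dir_deriv f v y $ i \<le> dir_deriv f v z $ i"
    by (intro tendsto_le[of "at_right (0::real)"]) auto
qed

lemma matrix_vector_mult_mono:
  fixes M :: "real^'n^'m"
  assumes "\<And>i j. 0 \<le> M $ i $ j" "y \<le> z"
  shows "M *v y \<le> M *v z"
  using assms by (auto simp: vec_le_iff matrix_vector_mult_def intro!: sum_mono mult_left_mono)

text \<open>The directional derivative is monotone and dominates every subgradient, so the iterates
  of \<open>1\<close> under \<open>M\<close> stay below its orbit under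
  \<open>dir_deriv f v\<close>. A bound for this one vector is what
  \<open>limit_projection_exists\<close> asks for.\<close>

lemma t_stable_powers_bounded:
  fixes f :: "real^'n \<Rightarrow> real^'n"
  assumes "open D" "convex_map_on D f" "mono_on D f" "t_stable_fixed_point D f v"
    and M: "M \<in> subdifferential D f v"
  shows "\<exists>B. \<forall>k i. (((*v) M ^^ k) 1) $ i \<le> B"
proof -
  have v: "v \<in> D" using assms(4) by (simp add: t_stable_fixed_point_def)
  obtain b where b: "\<And>k. (dir_deriv f v ^^ k) 1 \<le> b"
    using assms(4) unfolding t_stable_fixed_point_def bdd_above_def by (meson rangeI)
  have "((*v) M ^^ k) 1 \<le> (dir_deriv f v ^^ k) 1" for k
  proof (induction k)
    case (Suc k)
    have "M *v (((*v) M ^^ k) 1) \<le> dir_deriv f v (((*v) M ^^ k) 1)"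
      using dir_deriv_ge_subdifferential[OF assms(1,2) v M] .
    also have "\<dots> \<le> dir_deriv f v ((dir_deriv f v ^^ k) 1)"
      using dir_deriv_mono[OF assms(1,2) v assms(3) Suc] .
    finally show ?case by simp
  qed simp
  then have "(((*v) M ^^ k) 1) $ i \<le> b $ i" for k i
    using b order_trans unfolding vec_le_iff by blast
  moreover have "b $ i \<le> (\<Sum>i\<in>UNIV. \<bar>b $ i\<bar>)" for i
    using member_le_sum[of i UNIV "\<lambda>i. \<bar>b $ i\<bar>"] by (auto intro: order_trans[OF abs_ge_self])
  ultimately show ?thesis using order_trans by blast
qed

lemma funpow_in_set: "f \<in> D \<rightarrow> D \<Longrightarrow> x \<in> D \<Longrightarrow> (f ^^ k) x \<in> D"
  by (induction k) auto

lemma mono_on_funpow: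
  assumes "f \<in> D \<rightarrow> D" "mono_on D f"
  shows "mono_on D (f ^^ k)"
proof (induction k)
  case (Suc k)
  then show ?case
    using assms funpow_in_set[OF assms(1)] by (auto simp: mono_on_def)
qed (auto simp: mono_on_def)

lemma convex_map_on_funpow:
  fixes f :: "real^'n \<Rightarrow> real^'n"
  assumes "convex D" "f \<in> D \<rightarrow> D" "convex_map_on D f" "mono_on D f"
  shows "convex_map_on D (f ^^ k)"
proof (induction k)
  case 0
  show ?case using assms(1) by (auto simp: convex_map_on_def convex_on_def)
next
  case (Suc k)
  have "convex_on D (\<lambda>x. (f ^^ Suc k) x $ i)" for i
    unfolding convex_on_def
  proof (intro conjI ballI allI impI)
    fix x y and s t :: real
    assume xy: "x \<in> D" "y \<in> D" and st: "0 \<le> s" "0 \<le> t" "s + t = 1"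
    let ?x = "(f ^^ k) x" and ?y = "(f ^^ k) y"
    have D: "?x \<in> D" "?y \<in> D" "(f ^^ k) (s *\<^sub>R x + t *\<^sub>R y) \<in> D" "s *\<^sub>R ?x + t *\<^sub>R ?y \<in> D"
      using funpow_in_set[OF assms(2)] xy st convexD[OF assms(1)] by auto
    have "(f ^^ k) (s *\<^sub>R x + t *\<^sub>R y) \<le> s *\<^sub>R ?x + t *\<^sub>R ?y"
      using Suc xy st by (auto simp: convex_map_on_def convex_on_def vec_le_iff)
    from mono_onD[OF assms(4) D(3,4) this]
    have "(f ^^ Suc k) (s *\<^sub>R x + t *\<^sub>R y) $ i \<le> f (s *\<^sub>R ?x + t *\<^sub>R ?y) $ i" by (simp add: vec_le_iff)
    also have "\<dots> \<le> s * f ?x $ i + t * f ?y $ i"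
      using assms(3) D st by (auto simp: convex_map_on_def convex_on_def)
    finally show "(f ^^ Suc k) (s *\<^sub>R x + t *\<^sub>R y) $ i \<le> s * (f ^^ Suc k) x $ i + t * (f ^^ Suc k) y $ i" by simp
  qed (fact assms(1))
  then show ?case by (simp add: convex_map_on_def)
qed

text \<open>Chain rule for subgradients: \<open>M\<close> is nonnegative, so it may be applied to
  both sides of the inequality for \<open>R\<close>.\<close>

lemma subdifferential_funpow_Suc:
  fixes f :: "real^'n \<Rightarrow> real^'n"
  assumes "downward D" "f \<in> D \<rightarrow> D" "mono_on D f" "x \<in> D"
    and R: "R \<in> subdifferential D (f ^^ k) x" and M: "M \<in> subdifferential D f ((f ^^ k) x)"
  shows "M ** R \<in> subdifferential D (f ^^ Suc k) x"
proof -
  have "(M ** R) *v (y - x) \<le> (f ^^ Suc k) y - (f ^^ Suc k) x" if y: "y \<in> D" for y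
  proof -
    have "(M ** R) *v (y - x) = M *v (R *v (y - x))" by (simp add: matrix_vector_mul_assoc)
    also have "\<dots> \<le> M *v ((f ^^ k) y - (f ^^ k) x)"
      using R y subdifferential_nonneg[OF assms(1,3) funpow_in_set[OF assms(2,4)] M]
      by (intro matrix_vector_mult_mono) (auto simp: subdifferential_def)
    also have "\<dots> \<le> f ((f ^^ k) y) - f ((f ^^ k) x)"
      using M funpow_in_set[OF assms(2) y] by (auto simp: subdifferential_def)
    finally show ?thesis by simp
  qed
  then show ?thesis by (auto simp: subdifferential_def)
qed

section \<open>Critical classes and the spectral radius\<close>

lemma reachable_matrix_digraph:
  "i \<rightarrow>\<^sup>*\<^bsub>matrix_digraph P\<^esub> j \<longleftrightarrow> (i, j) \<in> {(a, b). P $ a $ b > 0}\<^sup>*"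
proof -
  have "arcs_ends (matrix_digraph P) = {(a, b). P $ a $ b > 0}"
    by (force simp: arcs_ends_def arc_to_ends_def matrix_digraph_def)
  moreover have "rtrancl_on UNIV r = r\<^sup>*" for r :: "('a \<times> 'a) set"
  proof -
    have "(a, b) \<in> rtrancl_on UNIV r \<Longrightarrow> (a, b) \<in> r\<^sup>*" for a b
      by (induction rule: rtrancl_on_induct) auto
    moreover have "(a, b) \<in> r\<^sup>* \<Longrightarrow> (a, b) \<in> rtrancl_on UNIV r" for a b
      by (induction rule: rtrancl_induct) (auto intro: rtrancl_on_into_rtrancl_on)
    ultimately show ?thesis by auto
  qed
  ultimately show ?thesis by (simp add: reachable_def matrix_digraph_def)
qed

text \<open>\<open>y\<close> consists of the moduli of an eigenvector, extended by zero outside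
  \<open>K\<close>; the bound is the triangle inequality.\<close>

lemma eigenvalue_diagonal_block_bound:
  fixes P :: "real^'n^'n"
  assumes nonneg: "\<And>i j. 0 \<le> P $ i $ j" and ev: "eigenvalue (diagonal_block P K) \<mu>"
  obtains y :: "'n \<Rightarrow> real" where "\<And>j. 0 \<le> y j" "\<And>j. j \<notin> K \<Longrightarrow> y j = 0" "\<exists>j\<in>K. y j > 0"
    "\<And>j. norm \<mu> * y j \<le> mat_app UNIV (\<lambda>i j. P $ i $ j) y j"
proof -
  define n where "n = card K"
  define e where "e = from_nat_into K"
  have bij: "bij_betw e {..<n} K" unfolding e_def n_def by (rule bij_betw_from_nat_into_finite) simp
  define B where "B = diagonal_block P K"
  have B: "B \<in> carrier_mat n n" by (simp add: B_def diagonal_block_def n_def)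
  obtain x where x: "x \<in> carrier_vec n" "x \<noteq> 0\<^sub>v n" "B *\<^sub>v x = \<mu> \<cdot>\<^sub>v x"
    using ev B unfolding eigenvalue_def eigenvector_def B_def[symmetric] by auto
  define y where "y j = (if j \<in> K then norm (vec_index x (inv_into {..<n} e j)) else 0)" for j
  have ye: "y (e a) = norm (vec_index x a)" "e a \<in> K" if "a < n" for a
    using bij that by (auto simp: y_def bij_betw_def inv_into_f_f)
  have le: "norm \<mu> * y (e a) \<le> (\<Sum>l\<in>K. P $ e a $ l * y l)" if a: "a < n" for a
  proof -
    have "\<mu> * vec_index x a = vec_index (B *\<^sub>v x) a" using x a by simp
    also have "\<dots> = (\<Sum>b<n. complex_of_real (P $ e a $ e b) * vec_index x b)"
      using a x(1) B by (auto simp: scalar_prod_def B_def diagonal_block_def n_def e_def atLeast0LessThan intro!: sum.cong)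
    finally have "norm \<mu> * norm (vec_index x a) = norm (\<Sum>b<n. complex_of_real (P $ e a $ e b) * vec_index x b)"
      by (metis norm_mult)
    also have "\<dots> \<le> (\<Sum>b<n. P $ e a $ e b * norm (vec_index x b))"
      using nonneg by (intro sum_norm_le) (simp add: norm_mult)
    also have "\<dots> = (\<Sum>b<n. P $ e a $ e b * y (e b))" using ye by (intro sum.cong) auto
    also have "\<dots> = (\<Sum>l\<in>K. P $ e a $ l * y l)" by (rule sum.reindex_bij_betw[OF bij])
    finally show ?thesis using ye[OF a] by simp
  qed
  show ?thesis
  proof (rule that[of y])
    show "0 \<le> y j" for j by (simp add: y_def)
    show "y j = 0" if "j \<notin> K" for j using that by (simp add: y_def)
    obtain a where a: "a < n" "vec_index x a \<noteq> 0"
      using x(1,2) by (metis carrier_vecD eq_vecI index_zero_vec)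
    then show "\<exists>j\<in>K. y j > 0" using ye[OF a(1)] by (metis zero_less_norm_iff)
    show "norm \<mu> * y j \<le> mat_app UNIV (\<lambda>i j. P $ i $ j) y j" for j
    proof (cases "j \<in> K")
      case True
      then obtain a where "a < n" "j = e a" using bij by (auto simp: bij_betw_def)
      then have "norm \<mu> * y j \<le> (\<Sum>l\<in>K. P $ j $ l * y l)" using le by simp
      also have "\<dots> \<le> (\<Sum>l\<in>UNIV. P $ j $ l * y l)"
        using nonneg by (intro sum_mono2) (auto simp: y_def)
      finally show ?thesis by (simp add: mat_app_def)
    next
      case False
      then show ?thesis using nonneg by (auto simp: mat_app_def y_def intro!: sum_nonneg)
    qed
  qed
qed

text \<open>\<open>m\<close> is a left eigenvector of the block; the eigenvalue passes from the
  transpose through the characteristic polynomial.\<close>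

lemma eigenvalue_diagonal_block_one:
  fixes P :: "real^'n^'n"
  assumes m: "\<And>j. j \<in> K \<Longrightarrow> (\<Sum>l\<in>K. m l * P $ l $ j) = m j" and i: "i \<in> K" "m i \<noteq> 0"
  shows "eigenvalue (diagonal_block P K) 1"
proof -
  define n where "n = card K"
  define e where "e = from_nat_into K"
  have bij: "bij_betw e {..<n} K" unfolding e_def n_def by (rule bij_betw_from_nat_into_finite) simp
  define B where "B = diagonal_block P K"
  have B: "B \<in> carrier_mat n n" "transpose_mat B \<in> carrier_mat n n" by (simp_all add: B_def diagonal_block_def n_def)
  define x where "x = Matrix.vec n (\<lambda>a. complex_of_real (m (e a)))"
  have "transpose_mat B *\<^sub>v x = x"
  proof (rule eq_vecI)
    fix a assume "a < dim_vec x"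
    then have a: "a < n" "e a \<in> K" using bij by (auto simp: x_def bij_betw_def)
    have "vec_index (transpose_mat B *\<^sub>v x) a = (\<Sum>b<n. complex_of_real (P $ e b $ e a) * complex_of_real (m (e b)))"
      using a B by (auto simp: scalar_prod_def x_def B_def diagonal_block_def n_def e_def atLeast0LessThan intro!: sum.cong)
    also have "\<dots> = complex_of_real (\<Sum>b<n. m (e b) * P $ e b $ e a)" by (simp add: mult.commute)
    also have "(\<Sum>b<n. m (e b) * P $ e b $ e a) = (\<Sum>l\<in>K. m l * P $ l $ e a)"
      by (rule sum.reindex_bij_betw[OF bij])
    also have "\<dots> = m (e a)" using m a by simp
    finally show "vec_index (transpose_mat B *\<^sub>v x) a = vec_index x a" using a by (simp add: x_def)
  qed (use B in \<open>simp add: x_def\<close>)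
  moreover have "x \<noteq> 0\<^sub>v n"
  proof
    assume "x = 0\<^sub>v n"
    obtain a where "a < n" "e a = i" using bij i by (auto simp: bij_betw_def)
    then have "vec_index x a = complex_of_real (m i)" by (simp add: x_def)
    then show False using \<open>x = 0\<^sub>v n\<close> \<open>a < n\<close> i by simp
  qed
  moreover have "x \<in> carrier_vec n" by (simp add: x_def)
  ultimately have "eigenvalue (transpose_mat B) 1"
    using B unfolding eigenvalue_def eigenvector_def by (intro exI[of _ x]) auto
  then have "eigenvalue B 1"
    using eigenvalue_root_char_poly[OF B(1)] eigenvalue_root_char_poly[OF B(2)] char_poly_transpose_mat[OF B(1)] by simp
  then show ?thesis by (simp add: B_def)
qed

text \<open>Spectral radius 1 yields a nonzero nonnegative sub-invariant vector supported in the
  class, so \<open>E\<close> joins two of its nodes, and paths carry this to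
  \<open>E i i > 0\<close>. Conversely, row \<open>i\<close> of \<open>E\<close> is a left
  eigenvector of the block for 1, and an eigenvalue of modulus above 1 would contradict
  \<open>E A = E\<close>.\<close>

lemma critical_nodes_iff:
  fixes P :: "real^'n^'n"
  assumes "limit_projection UNIV (\<lambda>i j. P $ i $ j) E"
  shows "i \<in> critical_nodes P \<longleftrightarrow> E i i > 0"
proof -
  interpret limit_projection UNIV "\<lambda>i j. P $ i $ j" E by fact
  define r where "r = {(a, b). P $ a $ b > 0}\<^sup>*"
  define cl where "cl k = {j. (k, j) \<in> r \<and> (j, k) \<in> r}" for k
  have nonneg: "0 \<le> P $ a $ b" for a b using A_nonneg by simp
  have path: "(a, b) \<in> r" if "E a b > 0" for a b using E_path[OF _ _ that] by (simp add: r_def)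
  have rE: "E a c > 0" if "(a, b) \<in> r" "E b c > 0" for a b c
    using path_E_pos[of a b c] that by (simp add: r_def)
  have Er: "E a c > 0" if "E a b > 0" "(b, c) \<in> r" for a b c
    using E_path_pos[of b c a] that by (simp add: r_def)
  have acc: "access_classes P = range cl"
    by (auto simp: access_classes_def quotient_def reachable_matrix_digraph cl_def r_def)
  have block: "diagonal_block P K \<in> carrier_mat (card K) (card K)" for K by (simp add: diagonal_block_def)
  show ?thesis
  proof
    assume "i \<in> critical_nodes P"
    then obtain k where k: "i \<in> cl k" "spectral_radius (diagonal_block P (cl k)) = 1"
      by (auto simp: critical_nodes_def critical_classes_def acc)
    have card: "card (cl k) > 0" using k by (auto simp: card_gt_0_iff)
    obtain \<mu> where \<mu>: "eigenvalue (diagonal_block P (cl k)) \<mu>" "norm \<mu> = 1"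
      using spectral_radius_mem_max(1)[OF block card] k(2) by (auto simp: spectrum_def)
    from eigenvalue_diagonal_block_bound[OF nonneg \<mu>(1)]
    obtain y where y: "\<And>j. 0 \<le> y j" "\<And>j. j \<notin> cl k \<Longrightarrow> y j = 0" "\<exists>j\<in>cl k. y j > 0"
      "\<And>j. norm \<mu> * y j \<le> mat_app UNIV (\<lambda>i j. P $ i $ j) y j" by blast
    from y(3) obtain j where j: "j \<in> cl k" "y j > 0" by blast
    have "y j \<le> mat_app UNIV E y j" using y(4) \<mu>(2) by (intro sub_app) auto
    then have "(\<Sum>l\<in>UNIV. E j l * y l) > 0" using j by (simp add: mat_app_def)
    then obtain l where l: "E j l > 0" "y l > 0" using sum_pos_obtain[of "E j" y] E_nonneg y(1) by auto
    then have "l \<in> cl k" using y(2) by force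
    then have "(i, j) \<in> r" "(l, i) \<in> r" using j k(1) by (auto simp: cl_def r_def)
    then show "E i i > 0" using rE Er l(1) by blast
  next
    assume i: "E i i > 0"
    let ?K = "cl i"
    have iK: "i \<in> ?K" by (simp add: cl_def r_def)
    have "(\<Sum>l\<in>?K. E i l * P $ l $ j) = E i j" if j: "j \<in> ?K" for j
    proof -
      have "(\<Sum>l\<in>?K. E i l * P $ l $ j) = (\<Sum>l\<in>UNIV. E i l * P $ l $ j)"
      proof (rule sum.mono_neutral_left)
        \<comment> \<open>A nonzero term would place \<open>l\<close> on a path from
          \<open>i\<close> to \<open>j\<close>; as \<open>j\<close> leads back to \<open>i\<close>,
          \<open>l\<close> would lie in the class.\<close>
        show "\<forall>l\<in>UNIV - ?K. E i l * P $ l $ j = 0"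
        proof
          fix l assume l: "l \<in> UNIV - ?K"
          show "E i l * P $ l $ j = 0"
          proof (rule ccontr)
            assume "E i l * P $ l $ j \<noteq> 0"
            then have "E i l > 0" "P $ l $ j > 0" using nonneg[of l j] E_nonneg[of i l] by auto
            then have "(i, l) \<in> r" "(l, j) \<in> r" using path by (auto simp: r_def)
            moreover have "(j, i) \<in> r" using j by (simp add: cl_def)
            ultimately have "(l, i) \<in> r" unfolding r_def by (meson rtrancl_trans)
            with \<open>(i, l) \<in> r\<close> l show False by (simp add: cl_def)
          qed
        qed
      qed auto
      then show ?thesis using EA by simp
    qed
    then have "eigenvalue (diagonal_block P ?K) 1"
      using eigenvalue_diagonal_block_one[of ?K "E i" P i] iK i by simp
    then have "1 \<in> norm ` spectrum (diagonal_block P ?K)" by (force simp: spectrum_def)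
    moreover have card: "card ?K > 0" using iK by (auto simp: card_gt_0_iff)
    ultimately have ge: "spectral_radius (diagonal_block P ?K) \<ge> 1"
      using spectral_radius_mem_max(2)[OF block] by blast
    obtain \<mu> where \<mu>: "eigenvalue (diagonal_block P ?K) \<mu>" "norm \<mu> = spectral_radius (diagonal_block P ?K)"
      using spectral_radius_mem_max(1)[OF block card] by (auto simp: spectrum_def)
    from eigenvalue_diagonal_block_bound[OF nonneg \<mu>(1)]
    obtain y where y: "\<And>j. 0 \<le> y j" "\<And>j. j \<notin> ?K \<Longrightarrow> y j = 0" "\<exists>j\<in>?K. y j > 0"
      "\<And>j. norm \<mu> * y j \<le> mat_app UNIV (\<lambda>i j. P $ i $ j) y j" by blast
    have "norm \<mu> \<le> 1"
    proof (rule ccontr)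
      assume "\<not> norm \<mu> \<le> 1"
      then have gt: "norm \<mu> > 1" by simp
      from y(3) obtain j where j: "y j > 0" by blast
      have sub: "y a \<le> mat_app UNIV (\<lambda>i j. P $ i $ j) y a" for a
        using y(4)[of a] mult_right_mono[of 1 "norm \<mu>" "y a"] gt y(1)[of a] by simp
      have "mat_app UNIV E (\<lambda>a. norm \<mu> * y a) j \<le> mat_app UNIV E (mat_app UNIV (\<lambda>i j. P $ i $ j) y) j"
        using E_nonneg y(4) by (intro mat_app_mono) auto
      then have "norm \<mu> * mat_app UNIV E y j \<le> mat_app UNIV E y j"
        unfolding E_app_A[OF UNIV_I] by (simp add: mat_app_def sum_distrib_left mult.left_commute)
      then have "(norm \<mu> - 1) * mat_app UNIV E y j \<le> 0" by (simp add: algebra_simps)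
      moreover have "mat_app UNIV E y j > 0" using sub_app[OF sub UNIV_I, of j] j by simp
      ultimately show False using gt by (simp add: mult_le_0_iff)
    qed
    then have "spectral_radius (diagonal_block P ?K) = 1" using ge \<mu>(2) by simp
    then show "i \<in> critical_nodes P"
      using iK by (auto simp: critical_nodes_def critical_classes_def acc)
  qed
qed

section \<open>Linearisation along a periodic orbit\<close>

lemma mat_app_matrix: "mat_app UNIV (\<lambda>i j. M $ i $ j) (\<lambda>i. y $ i) i = (M *v y) $ i"
  by (simp add: mat_app_def matrix_vector_mult_def)

lemma funpow_mat_app_matrix:
  "(mat_app UNIV (\<lambda>i j. M $ i $ j) ^^ k) (\<lambda>i. y $ i) = (\<lambda>i. (((*v) M ^^ k) y) $ i)"
  by (induction k) (auto simp: mat_app_matrix)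

locale convex_monotone_periodic =
  fixes D :: "(real^'n) set" and f :: "real^'n \<Rightarrow> real^'n" and v \<xi> :: "real^'n" and p :: nat
  assumes D: "open D" "convex D" "downward D" and fD: "f \<in> D \<rightarrow> D"
    and convex: "convex_map_on D f" and mono: "mono_on D f"
    and v: "t_stable_fixed_point D f v"
    and p: "p > 0" and \<xi>: "t_stable_fixed_point D (f ^^ p) \<xi>"
begin

abbreviation orb :: "nat \<Rightarrow> real^'n" where "orb k \<equiv> (f ^^ k) \<xi>"
abbreviation dev :: "nat \<Rightarrow> 'n \<Rightarrow> real" where "dev k \<equiv> \<lambda>i. orb k $ i - v $ i"
abbreviation entries :: "real^'n^'n \<Rightarrow> 'n \<Rightarrow> 'n \<Rightarrow> real" where "entries P \<equiv> \<lambda>i j. P $ i $ j"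

lemma vD: "v \<in> D" and fv: "f v = v"
  using v by (auto simp: t_stable_fixed_point_def)

lemma orb_D: "orb k \<in> D"
  using \<xi> funpow_in_set[OF fD] by (auto simp: t_stable_fixed_point_def)

lemma orb_mod: "orb (k mod p) = orb k"
  using \<xi> by (intro funpow_mod_eq) (auto simp: t_stable_fixed_point_def)

lemma orb_p: "orb p = \<xi>"
  using \<xi> by (auto simp: t_stable_fixed_point_def)

lemma subdiff_nonneg: "x \<in> D \<Longrightarrow> P \<in> subdifferential D f x \<Longrightarrow> 0 \<le> P $ i $ j"
  using subdifferential_nonneg[OF D(3) mono] .

lemma projection_exists:
  assumes P: "P \<in> subdifferential D f v"
  obtains E where "limit_projection UNIV (entries P) E"
proof -
  obtain B where B: "\<And>k i. (((*v) P ^^ k) 1) $ i \<le> B"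
    using t_stable_powers_bounded[OF D(1) convex mono v P] by blast
  have "(mat_app UNIV (entries P) ^^ k) (\<lambda>_. 1) i \<le> B" for k i
    using funpow_mat_app_matrix[where M = P and k = k and y = 1] B[of k i] by simp
  then show ?thesis
    using limit_projection_exists[of UNIV "entries P" B] subdiff_nonneg[OF vD P] that by auto
qed

lemma dev_ge:
  assumes "P \<in> subdifferential D f v"
  shows "mat_app UNIV (entries P) (dev k) i \<le> dev (Suc k) i"
proof -
  have "P *v (orb k - v) \<le> f (orb k) - f v" using assms orb_D by (auto simp: subdifferential_def)
  then have "(P *v (orb k - v)) $ i \<le> orb (Suc k) $ i - v $ i" by (simp add: vec_le_iff fv)
  then show ?thesis using mat_app_matrix[of P "orb k - v" i] by simp
qed

text \<open>The sum \<open>S\<close> over a period is unchanged by the time shift, so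
  \<open>dev_ge\<close> makes it super-invariant and \<open>critical_eq'\<close> gives equality at
  \<open>i\<close>. The gaps in \<open>dev_ge\<close> are nonnegative and add up to zero
  there.\<close>

lemma dev_eq_critical:
  assumes P: "P \<in> subdifferential D f v" and "limit_projection UNIV (entries P) E" and i: "E i i > 0"
  shows "mat_app UNIV (entries P) (dev k) i = dev (Suc k) i"
proof -
  interpret limit_projection UNIV "entries P" E by fact
  define S where "S j = (\<Sum>k<p. dev k j)" for j
  have shift: "(\<Sum>k<p. dev (Suc k) j) = S j" for j
  proof -
    have "(\<Sum>k<p. dev (Suc k) j) - (\<Sum>k<p. dev k j) = dev p j - dev 0 j"
      using sum_lessThan_telescope[of "\<lambda>k. dev k j" p] by (simp only: sum_subtractf)
    then show ?thesis using orb_p by (simp add: S_def)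
  qed
  have app: "mat_app UNIV (entries P) S j = (\<Sum>k<p. mat_app UNIV (entries P) (dev k) j)" for j
    unfolding mat_app_def S_def sum_distrib_left by (rule sum.swap)
  have "mat_app UNIV (entries P) S j \<le> S j" for j
    unfolding app shift[symmetric] using dev_ge[OF P] by (intro sum_mono) auto
  then have "mat_app UNIV (entries P) S i = S i" using critical_eq'(1) i by blast
  then have "(\<Sum>k<p. dev (Suc k) i - mat_app UNIV (entries P) (dev k) i) = 0"
    unfolding sum_subtractf[of "\<lambda>k. dev (Suc k) i"] shift app[symmetric] by simp
  then have "\<forall>k\<in>{..<p}. dev (Suc k) i - mat_app UNIV (entries P) (dev k) i = 0"
    using dev_ge[OF P] by (subst (asm) sum_nonneg_eq_0_iff) auto
  then have "dev (Suc (k mod p)) i - mat_app UNIV (entries P) (dev (k mod p)) i = 0"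
    using p by simp
  moreover have "orb (Suc (k mod p)) = orb (Suc k)" using orb_mod by simp
  ultimately show ?thesis using orb_mod[of k] by simp
qed

text \<open>By \<open>dev_eq_critical\<close> the affine minorant of coordinate \<open>i\<close> of
  \<open>f\<close> taken at \<open>v\<close> also touches it at every point of the orbit.\<close>

lemma row_subgradient_orb:
  assumes P: "P \<in> subdifferential D f v" and E: "limit_projection UNIV (entries P) E" and i: "E i i > 0"
  shows "row_subgradient D f (orb k) i (P $ i)"
  unfolding row_subgradient_def
proof
  fix x assume x: "x \<in> D"
  have "P $ i \<bullet> (x - v) \<le> f x $ i - f v $ i"
    using P x unfolding subdifferential_iff_rows row_subgradient_def by blast
  moreover have "P $ i \<bullet> (orb k - v) = orb (Suc k) $ i - v $ i"
    using dev_eq_critical[OF P E i, of k] mat_app_matrix[of P "orb k - v" i]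
    by (simp add: matrix_vector_mul_component)
  ultimately show "P $ i \<bullet> (x - orb k) \<le> f x $ i - f (orb k) $ i"
    by (simp add: fv inner_diff_right)
qed

section \<open>The space-time matrix of the linearisations\<close>

definition prv :: "nat \<Rightarrow> nat" where "prv k = (if k = 0 then p - 1 else k - 1)"
definition nxt :: "nat \<Rightarrow> nat" where "nxt k = Suc k mod p"
abbreviation T :: "('n \<times> nat) set" where "T \<equiv> UNIV \<times> {..<p}"

text \<open>
  The linearisations \<open>Q m\<close> along the orbit, assembled into a single matrix on space-time: the
  arcs from time \<open>k\<close> lead to time \<open>k - 1\<close> modulo \<open>p\<close>.
\<close>

definition lift :: "(nat \<Rightarrow> real^'n^'n) \<Rightarrow> 'n \<times> nat \<Rightarrow> 'n \<times> nat \<Rightarrow> real" where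
  "lift Q = (\<lambda>(i, k) (l, m). if m = prv k then Q m $ i $ l else 0)"

lemma prv_less: "k < p \<Longrightarrow> prv k < p" and nxt_less: "nxt k < p"
  using p by (auto simp: prv_def nxt_def)

lemma prv_eq_iff: "k < p \<Longrightarrow> m < p \<Longrightarrow> m = prv k \<longleftrightarrow> k = nxt m"
  using p by (cases "Suc m = p") (auto simp: prv_def nxt_def)

lemma prv_nxt: "m < p \<Longrightarrow> prv (nxt m) = m"
  using prv_eq_iff[of "nxt m" m] nxt_less by simp

lemma orb_Suc_prv: "orb (Suc (prv k)) = orb k"
  using p orb_p by (cases k) (auto simp: prv_def simp del: funpow.simps)

lemma orb_Suc_prv_add: "orb (Suc (prv k + c)) = orb (k + c)"
proof -
  have "orb (Suc (prv k + c)) = (f ^^ c) (orb (Suc (prv k)))"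
    by (metis add.commute add_Suc funpow_add o_apply)
  then show ?thesis unfolding orb_Suc_prv by (metis add.commute funpow_add o_apply)
qed

lemma finite_T: "finite T" by simp

lemma lift_app:
  assumes "k < p"
  shows "mat_app T (lift Q) y (i, k) = (\<Sum>l\<in>UNIV. Q (prv k) $ i $ l * y (l, prv k))"
proof -
  have "mat_app T (lift Q) y (i, k) = (\<Sum>l\<in>UNIV. \<Sum>m<p. lift Q (i, k) (l, m) * y (l, m))"
    unfolding mat_app_def by (simp add: sum.cartesian_product)
  also have "\<dots> = (\<Sum>l\<in>UNIV. Q (prv k) $ i $ l * y (l, prv k))"
    using prv_less[OF assms]
    by (simp add: lift_def if_distrib[of "\<lambda>t. t * _"] sum.delta cong: if_cong)
  finally show ?thesis .
qed

lemma lift_left: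
  assumes m: "m < p"
  shows "(\<Sum>\<tau>\<in>T. w \<tau> * lift Q \<tau> (l, m)) = (\<Sum>j\<in>UNIV. w (j, nxt m) * Q m $ j $ l)"
proof -
  have "(\<Sum>\<tau>\<in>T. w \<tau> * lift Q \<tau> (l, m)) = (\<Sum>j\<in>UNIV. \<Sum>k<p. w (j, k) * lift Q (j, k) (l, m))"
    by (simp add: sum.cartesian_product)
  also have "\<dots> = (\<Sum>j\<in>UNIV. \<Sum>k<p. if k = nxt m then w (j, k) * Q m $ j $ l else 0)"
    using m prv_eq_iff by (intro sum.cong) (auto simp: lift_def)
  also have "\<dots> = (\<Sum>j\<in>UNIV. w (j, nxt m) * Q m $ j $ l)"
    using nxt_less by (simp add: sum.delta)
  finally show ?thesis .
qed

lemma matrix_vector_scaleR: "(M :: real^'n^'n) *v (c *\<^sub>R x) = c *\<^sub>R (M *v x)"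
  by (simp add: Finite_Cartesian_Product.vec_eq_iff matrix_vector_mult_def sum_distrib_left mult.left_commute)

context
  fixes Q :: "nat \<Rightarrow> real^'n^'n"
  assumes Q: "\<And>m. m < p \<Longrightarrow> Q m \<in> subdifferential D f (orb m)"
begin

lemma Q_nonneg: "m < p \<Longrightarrow> 0 \<le> Q m $ i $ j"
  using subdiff_nonneg[OF orb_D Q] .

lemma lift_nonneg: "\<tau> \<in> T \<Longrightarrow> \<sigma> \<in> T \<Longrightarrow> 0 \<le> lift Q \<tau> \<sigma>"
  using Q_nonneg by (auto simp: lift_def)

text \<open>A full turn through time 0 multiplies the iterates of \<open>1\<close> by
  \<open>R p\<close>, a subgradient of \<open>f ^^ p\<close> at \<open>\<xi>\<close> by the chain
  rule; t-stability of \<open>\<xi>\<close> bounds its powers. Incomplete turns have fewer than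
  \<open>p\<close> steps and cost at most a factor \<open>c ^ p\<close> each.\<close>

lemma lift_projection_exists:
  obtains E where "limit_projection T (lift Q) E"
proof -
  \<comment> \<open>\<open>z m k\<close> collects the values at time \<open>k\<close> of the
    \<open>m\<close>-th iterate of \<open>1\<close> under \<open>lift Q\<close>.\<close>
  define z where "z = rec_nat (\<lambda>k. 1 :: real^'n) (\<lambda>m zm k. Q (prv k) *v zm (prv k))"
  have z0: "z 0 k = 1" and zS: "z (Suc m) k = Q (prv k) *v z m (prv k)" for m k
    by (simp_all add: z_def)
  have zT: "(mat_app T (lift Q) ^^ m) (\<lambda>_. 1) (i, k) = z m k $ i" if "k < p" for m k i
    using that
  proof (induction m arbitrary: k i)
    case (Suc m)
    have "(mat_app T (lift Q) ^^ Suc m) (\<lambda>_. 1) (i, k) = (\<Sum>l\<in>UNIV. Q (prv k) $ i $ l * z m (prv k) $ l)"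
      using lift_app[OF Suc.prems] Suc.IH[OF prv_less[OF Suc.prems]] by simp
    then show ?case by (simp add: zS matrix_vector_mult_def)
  qed (simp add: z0)
  \<comment> \<open>\<open>R j\<close> multiplies the linearisations at the times below
    \<open>j\<close>, the latest on the left.\<close>
  define R where "R = rec_nat (Finite_Cartesian_Product.mat 1 :: real^'n^'n) (\<lambda>j Rj. Q j ** Rj)"
  have R0: "R 0 = Finite_Cartesian_Product.mat 1" and RS: "R (Suc j) = Q j ** R j" for j by (simp_all add: R_def)
  have Rsub: "R j \<in> subdifferential D (f ^^ j) \<xi>" if "j \<le> p" for j
    using that
  proof (induction j)
    case 0
    show ?case by (simp add: R0 subdifferential_def)
  next
    case (Suc j)
    then show ?case unfolding RS
      using orb_D[of 0] Q by (intro subdifferential_funpow_Suc[OF D(3) fD mono]) auto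
  qed
  have \<xi>D: "\<xi> \<in> D" using orb_D[of 0] by simp
  have Rnn: "0 \<le> R j $ a $ b" if "j \<le> p" for j a b
    using subdifferential_nonneg[OF D(3) mono_on_funpow[OF fD mono] \<xi>D Rsub[OF that]] .
  have zR: "z (m + j) j = R j *v z m 0" if "j < p" for m j
    using that
  proof (induction j)
    case (Suc j)
    then show ?case by (simp add: zS prv_def RS matrix_vector_mul_assoc)
  qed (simp add: R0)
  have zp: "z (m + p) 0 = R p *v z m 0" for m
  proof -
    obtain q where q: "p = Suc q" using p by (cases p) auto
    have "prv 0 = q" unfolding prv_def using q by simp
    moreover have "z (m + p) 0 = z (Suc (m + q)) 0" using q by simp
    ultimately have "z (m + p) 0 = Q q *v z (m + q) q" by (simp only: zS)
    also have "\<dots> = R p *v z m 0" using zR[of q m] q by (simp add: RS matrix_vector_mul_assoc)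
    finally show ?thesis .
  qed
  obtain B where B: "\<And>k i. (((*v) (R p) ^^ k) 1) $ i \<le> B"
    using t_stable_powers_bounded[OF D(1) convex_map_on_funpow[OF D(2) fD convex mono] mono_on_funpow[OF fD mono] \<xi> Rsub[OF order_refl]]
    by blast
  have B1: "B \<ge> 1" using B[of 0] by simp
  \<comment> \<open>Making \<open>c\<close> at least 1 allows every exponent up to \<open>p\<close>
    to be replaced by \<open>p\<close>.\<close>
  define c where "c = \<bar>Max ((\<lambda>(m, i). (Q m *v 1) $ i) ` ({..<p} \<times> UNIV))\<bar> + 1"
  have C: "(Q m *v 1) $ i \<le> c" if "m < p" for m i
  proof -
    have "(Q m *v 1) $ i \<le> Max ((\<lambda>(m, i). (Q m *v 1) $ i) ` ({..<p} \<times> UNIV))"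
      using that by (intro Max_ge) force+
    then show ?thesis by (simp add: c_def)
  qed
  have c1: "c \<ge> 1" by (simp add: c_def)
  have Qc: "Q m *v 1 \<le> c *\<^sub>R 1" if "m < p" for m using C that by (simp add: vec_le_iff)
  have zc: "z m k \<le> c ^ m *\<^sub>R 1" if "k < p" for m k
    using that
  proof (induction m arbitrary: k)
    case (Suc m)
    have "z (Suc m) k \<le> Q (prv k) *v (c ^ m *\<^sub>R 1)"
      unfolding zS using Suc prv_less Q_nonneg by (intro matrix_vector_mult_mono) auto
    also have "\<dots> = c ^ m *\<^sub>R (Q (prv k) *v 1)" by (rule matrix_vector_scaleR)
    also have "\<dots> \<le> c ^ m *\<^sub>R (c *\<^sub>R 1)"
      using Qc[OF prv_less[OF Suc.prems]] c1 by (simp add: vec_le_iff)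
    finally show ?case by (simp add: mult.commute)
  qed (simp add: z0)
  have z0b: "z m 0 \<le> (c ^ p * B) *\<^sub>R 1" for m
  proof -
    have *: "z (r + p * t) 0 = ((*v) (R p) ^^ t) (z r 0)" for r t
    proof (induction t)
      case (Suc t)
      have "z (r + p * Suc t) 0 = R p *v z (r + p * t) 0" using zp[of "r + p * t"] by (simp add: algebra_simps)
      then show ?case using Suc by simp
    qed simp
    have **: "((*v) (R p) ^^ t) y \<le> a *\<^sub>R (((*v) (R p) ^^ t) 1)" if "y \<le> a *\<^sub>R 1" for t y and a :: real
    proof (induction t)
      case (Suc t)
      have "R p *v (((*v) (R p) ^^ t) y) \<le> R p *v (a *\<^sub>R (((*v) (R p) ^^ t) 1))"
        using Suc Rnn by (intro matrix_vector_mult_mono) auto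
      then show ?case by (simp add: matrix_vector_scaleR)
    qed (use that in simp)
    have le: "z (m mod p) 0 \<le> c ^ p *\<^sub>R 1"
    proof -
      have "c ^ (m mod p) \<le> c ^ p" using c1 p by (intro power_increasing) (auto simp: less_imp_le)
      then show ?thesis using zc[OF p, of "m mod p"] by (auto simp: vec_le_iff intro: order_trans)
    qed
    have "z m 0 = ((*v) (R p) ^^ (m div p)) (z (m mod p) 0)" using *[of "m mod p" "m div p"] by simp
    also have "\<dots> \<le> c ^ p *\<^sub>R (((*v) (R p) ^^ (m div p)) 1)" using **[OF le] .
    also have "\<dots> \<le> c ^ p *\<^sub>R (B *\<^sub>R 1)" using B c1 by (simp add: vec_le_iff)
    finally show ?thesis by simp
  qed
  \<comment> \<open>For \<open>k \<le> m\<close> the last \<open>k\<close> steps start from time 0;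
    otherwise there are fewer than \<open>p\<close> steps in all.\<close>
  have "z m k $ i \<le> c ^ p * B * c ^ p" if k: "k < p" for m k i
  proof (cases "k \<le> m")
    case True
    then have "z m k = R k *v z (m - k) 0" using zR[OF k, of "m - k"] by simp
    also have "\<dots> \<le> R k *v ((c ^ p * B) *\<^sub>R 1)"
      using z0b Rnn k by (intro matrix_vector_mult_mono) auto
    also have "\<dots> = (c ^ p * B) *\<^sub>R z k k" using zR[OF k, of 0] by (simp add: matrix_vector_scaleR z0)
    finally have "z m k $ i \<le> (c ^ p * B) * z k k $ i" by (simp add: vec_le_iff)
    also have "\<dots> \<le> (c ^ p * B) * c ^ p"
    proof (intro mult_left_mono)
      have "c ^ k \<le> c ^ p" using c1 k by (intro power_increasing) auto
      then show "z k k $ i \<le> c ^ p" using zc[OF k, of k] by (auto simp: vec_le_iff intro: order_trans)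
      show "0 \<le> c ^ p * B" using c1 B1 by simp
    qed
    finally show ?thesis .
  next
    case False
    have "z m k $ i \<le> c ^ m" using zc[OF k, of m] by (simp add: vec_le_iff)
    also have "\<dots> \<le> c ^ p" using c1 k False by (intro power_increasing) auto
    also have "\<dots> \<le> c ^ p * (B * c ^ p)"
    proof -
      have cp: "1 \<le> c ^ p" using c1 by (rule one_le_power)
      have "1 * 1 \<le> B * c ^ p" using B1 cp by (intro mult_mono) auto
      then show ?thesis using cp mult_left_mono[of 1 "B * c ^ p" "c ^ p"] by simp
    qed
    finally show ?thesis by (simp add: mult.assoc)
  qed
  then have bound: "(mat_app T (lift Q) ^^ m) (\<lambda>_. 1) \<tau> \<le> c ^ p * B * c ^ p" if "\<tau> \<in> T" for m \<tau>
    using zT that by auto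
  have "\<exists>E. limit_projection T (lift Q) E"
    by (rule limit_projection_exists[OF finite_T lift_nonneg bound])
  then show ?thesis using that by blast
qed

text \<open>The subgradient inequality at a point of the orbit, tested at \<open>v\<close>; it
  bounds \<open>dev\<close> on the side opposite to \<open>dev_ge\<close>.\<close>

lemma lift_dev:
  assumes "\<tau> \<in> T"
  shows "mat_app T (lift Q) (\<lambda>(j, k). - dev k j) \<tau> \<le> (case \<tau> of (j, k) \<Rightarrow> - dev k j)"
proof -
  obtain i k where \<tau>: "\<tau> = (i, k)" "k < p" using assms by auto
  let ?m = "prv k"
  have m: "?m < p" using prv_less \<tau> by blast
  have "Q ?m *v (v - orb ?m) \<le> f v - f (orb ?m)" using Q[OF m] vD by (auto simp: subdifferential_def)
  then have "(Q ?m *v (v - orb ?m)) $ i \<le> v $ i - orb (Suc ?m) $ i" by (simp add: vec_le_iff fv)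
  then have "(\<Sum>l\<in>UNIV. Q ?m $ i $ l * (- dev ?m l)) \<le> - dev k i"
    using mat_app_matrix[of "Q ?m" "v - orb ?m" i] unfolding orb_Suc_prv by (simp add: mat_app_def)
  then show ?thesis using \<tau> lift_app by simp
qed

text \<open>The subgradient inequality at a point of the orbit, tested at the point \<open>c\<close>
  steps later.\<close>

lemma lift_shift:
  assumes "\<tau> \<in> T"
  shows "(case \<tau> of (j, k) \<Rightarrow> orb k $ j - orb (k + c) $ j)
    \<le> mat_app T (lift Q) (\<lambda>(j, k). orb k $ j - orb (k + c) $ j) \<tau>"
proof -
  obtain i k where \<tau>: "\<tau> = (i, k)" "k < p" using assms by auto
  let ?m = "prv k"
  have m: "?m < p" using prv_less \<tau> by blast
  have "Q ?m *v (orb (?m + c) - orb ?m) \<le> f (orb (?m + c)) - f (orb ?m)" using Q[OF m] orb_D by (auto simp: subdifferential_def)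
  then have "(Q ?m *v (orb (?m + c) - orb ?m)) $ i \<le> orb (Suc (?m + c)) $ i - orb (Suc ?m) $ i" by (simp add: vec_le_iff)
  then have "(\<Sum>l\<in>UNIV. Q ?m $ i $ l * (orb (?m + c) $ l - orb ?m $ l)) \<le> orb (k + c) $ i - orb k $ i"
    using mat_app_matrix[of "Q ?m" "orb (?m + c) - orb ?m" i] unfolding orb_Suc_prv orb_Suc_prv_add by (simp add: mat_app_def)
  moreover have "(\<Sum>l\<in>UNIV. Q ?m $ i $ l * (orb (?m + c) $ l - orb ?m $ l)) = - (\<Sum>l\<in>UNIV. Q ?m $ i $ l * (orb ?m $ l - orb (?m + c) $ l))"
    by (simp add: sum_negf[symmetric] algebra_simps)
  ultimately show ?thesis using \<tau> lift_app by simp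
qed

end

section \<open>Deviations downstream of a critical class and along critical arcs\<close>

text \<open>The coordinatewise minimum \<open>b\<close> of the deviations over a period is
  super-invariant: apply \<open>dev_ge\<close> at the predecessor of a time that attains
  \<open>b j\<close>. Then \<open>downstream_nonneg\<close> applies to \<open>b\<close>.\<close>

lemma downstream_dev_ge_0:
  assumes P: "P \<in> subdifferential D f v" and "limit_projection UNIV (entries P) E"
    and i: "E i i > 0" "E i l > 0" "\<not> E l i > 0"
  shows "0 \<le> dev k l"
proof -
  interpret limit_projection UNIV "entries P" E by fact
  define b where "b j = Min ((\<lambda>k. dev k j) ` {..<p})" for j
  have b_le: "b j \<le> dev k j" for j k
  proof -
    have "dev (k mod p) j \<in> (\<lambda>k. dev k j) ` {..<p}" using p by (intro imageI) simp
    then have "b j \<le> dev (k mod p) j" unfolding b_def by (intro Min_le) auto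
    then show ?thesis using orb_mod by simp
  qed
  have "mat_app UNIV (entries P) b j \<le> b j" for j
  proof -
    have "b j \<in> (\<lambda>k. dev k j) ` {..<p}" unfolding b_def using p by (intro Min_in) auto
    then obtain k where k: "k < p" "b j = dev k j" by blast
    have "mat_app UNIV (entries P) b j \<le> mat_app UNIV (entries P) (dev (prv k)) j"
      using b_le A_nonneg by (intro mat_app_mono) auto
    also have "\<dots> \<le> dev (Suc (prv k)) j" using dev_ge[OF P] .
    finally show ?thesis using k orb_Suc_prv by simp
  qed
  then have "0 \<le> b l" using downstream_nonneg[of i l b] i by blast
  then show ?thesis using b_le order_trans by blast
qed

text \<open>
  The upper bound comes from linearising at the points of the orbit, with the critical rows of
  \<open>P\<close>, so that critical nodes of \<open>P\<close> remain critical in space-time.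
\<close>

lemma downstream_dev_le_0:
  assumes P: "P \<in> subdifferential D f v" and E: "limit_projection UNIV (entries P) E"
    and i: "E i i > 0" "P $ i $ l > 0" "\<not> E l i > 0" and k: "k < p"
  shows "dev k l \<le> 0"
proof -
  interpret limit_projection UNIV "entries P" E by fact
  have "\<exists>N. N \<in> subdifferential D f (orb m)" for m
    using subdifferential_nonempty[OF D(1) convex orb_D] .
  then obtain N where N: "\<And>m. N m \<in> subdifferential D f (orb m)" by metis
  \<comment> \<open>Critical rows of \<open>P\<close> are admissible by
    \<open>row_subgradient_orb\<close>; the other rows are filled arbitrarily.\<close>
  define Q where "Q m = (\<chi> j. if E j j > 0 then P $ j else N m $ j)" for m
  have Q: "Q m \<in> subdifferential D f (orb m)" for m
    using N[of m] row_subgradient_orb[OF P E] by (auto simp: subdifferential_iff_rows Q_def)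
  obtain F where F: "limit_projection T (lift Q) F" using lift_projection_exists[of Q, OF Q] .
  interpret F: limit_projection T "lift Q" F by fact
  define K where "K = {j. E i j > 0 \<and> E j i > 0}"
  have Kc: "E j j > 0" if "j \<in> K" for j using that E_trans[of j i j] by (simp add: K_def)
  \<comment> \<open>Column and row of \<open>E\<close> through \<open>i\<close>, restricted to the
    class of \<open>i\<close> and constant in time: the two vectors for
    \<open>certificate_critical\<close>.\<close>
  define u where "u = (\<lambda>(j, k :: nat). if j \<in> K then E j i else 0)"
  define w where "w = (\<lambda>(j, k :: nat). if j \<in> K then E i j else 0)"
  have Qnn: "0 \<le> Q m $ a $ b" for m a b using subdiff_nonneg[OF orb_D Q] .
  have u: "u \<tau> \<le> mat_app T (lift Q) u \<tau>" if \<tau>: "\<tau> \<in> T" for \<tau>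
  proof -
    obtain j m where jm: "\<tau> = (j, m)" "m < p" using \<tau> by auto
    have eq: "mat_app T (lift Q) u \<tau> = (\<Sum>q\<in>UNIV. Q (prv m) $ j $ q * u (q, prv m))"
      using lift_app jm by simp
    show ?thesis
    proof (cases "j \<in> K")
      case False
      then show ?thesis unfolding eq using Qnn E_nonneg by (auto simp: jm u_def intro!: sum_nonneg)
    next
      case True
      have "P $ j $ q * E q i = Q (prv m) $ j $ q * u (q, prv m)" for q
      proof (cases "P $ j $ q * E q i = 0")
        case False
        then have "P $ j $ q > 0" "E q i > 0" using A_nonneg[of j q] E_nonneg[of q i] by auto
        then have "E i q > 0" using E_A_pos[of i j q] True by (auto simp: K_def)
        then have "q \<in> K" using \<open>E q i > 0\<close> by (simp add: K_def)
        then show ?thesis using Kc[OF True] by (simp add: Q_def u_def)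
      next
        case zero: True
        then show ?thesis using Kc[OF True] by (auto simp: Q_def u_def)
      qed
      then have "(\<Sum>q\<in>UNIV. Q (prv m) $ j $ q * u (q, prv m)) = E j i" using AE[of j i] by simp
      then show ?thesis unfolding eq using True by (simp add: jm u_def)
    qed
  qed
  have w: "w \<tau> \<le> (\<Sum>\<sigma>\<in>T. w \<sigma> * lift Q \<sigma> \<tau>)" if \<tau>: "\<tau> \<in> T" for \<tau>
  proof -
    obtain q m where qm: "\<tau> = (q, m)" "m < p" using \<tau> by auto
    have eq: "(\<Sum>\<sigma>\<in>T. w \<sigma> * lift Q \<sigma> \<tau>) = (\<Sum>j\<in>UNIV. w (j, nxt m) * Q m $ j $ q)"
      using lift_left[OF qm(2)] qm by simp
    show ?thesis
    proof (cases "q \<in> K")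
      case False
      then show ?thesis unfolding eq using Qnn E_nonneg by (auto simp: qm w_def intro!: sum_nonneg)
    next
      case True
      have "E i j * P $ j $ q = w (j, nxt m) * Q m $ j $ q" for j
      proof (cases "E i j * P $ j $ q = 0")
        case False
        then have "E i j > 0" "P $ j $ q > 0" using A_nonneg[of j q] E_nonneg[of i j] by auto
        then have "E j i > 0" using A_E_pos[of j q i] True by (auto simp: K_def)
        then have "j \<in> K" using \<open>E i j > 0\<close> by (simp add: K_def)
        then show ?thesis using Kc by (simp add: Q_def w_def)
      next
        case zero: True
        then show ?thesis using Kc by (auto simp: Q_def w_def)
      qed
      then have "(\<Sum>j\<in>UNIV. w (j, nxt m) * Q m $ j $ q) = E i q" using EA[of i q] by simp
      then show ?thesis unfolding eq using True by (simp add: qm w_def)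
    qed
  qed
  have iK: "i \<in> K" using i by (simp add: K_def)
  have lK: "l \<notin> K" using i by (simp add: K_def)
  have Fi: "F (i, m) (i, m) > 0" if "m < p" for m
  proof (rule F.certificate_critical[of u w])
    show "0 \<le> u \<tau>" "0 \<le> w \<tau>" for \<tau> using E_nonneg by (auto simp: u_def w_def split: prod.splits)
    show "0 < u (i, m)" "0 < w (i, m)" using i iK by (auto simp: u_def w_def)
  qed (use u w that in auto)
  let ?\<tau> = "(i, nxt k)" and ?\<sigma> = "(l, k)"
  have T: "?\<tau> \<in> T" "?\<sigma> \<in> T" using nxt_less k by auto
  have "lift Q ?\<tau> ?\<sigma> > 0" using i(1,2) prv_nxt[OF k] by (simp add: lift_def Q_def)
  then have Fpos: "F ?\<tau> ?\<sigma> > 0" using F.E_A_pos[OF T(1) T(1) T(2)] Fi nxt_less by blast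
  \<comment> \<open>Otherwise \<open>?\<sigma>\<close> would be critical and \<open>u\<close> would
    be \<open>F\<close>-invariant there; but \<open>u\<close> vanishes at \<open>?\<sigma>\<close>,
    while the way back to \<open>?\<tau>\<close> contributes a positive term.\<close>
  have "\<not> 0 < F ?\<sigma> ?\<tau>"
  proof
    assume bk: "F ?\<sigma> ?\<tau> > 0"
    then have "F ?\<sigma> ?\<sigma> > 0" using F.E_trans[OF T(2,1,2)] Fpos by blast
    then have "mat_app T F u ?\<sigma> = u ?\<sigma>" using F.critical_eq(2)[of u ?\<sigma>] u T by blast
    also have "\<dots> = 0" using lK by (simp add: u_def)
    finally have "mat_app T F u ?\<sigma> = 0" .
    moreover have "mat_app T F u ?\<sigma> > 0" unfolding mat_app_def
    proof (rule F.sum_posI[of _ _ ?\<tau>])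
      show "0 \<le> u \<tau>" for \<tau> using E_nonneg by (auto simp: u_def split: prod.splits)
      show "0 < u ?\<tau>" using i iK by (simp add: u_def)
    qed (use bk T F.E_nonneg in auto)
    ultimately show False by simp
  qed
  from F.downstream_nonneg[OF T _ Fpos this lift_dev[of Q, OF Q]] Fi[OF nxt_less]
  show ?thesis by simp
qed

lemma downstream_dev:
  assumes P: "P \<in> subdifferential D f v" and E: "limit_projection UNIV (entries P) E"
    and i: "E i i > 0" "P $ i $ l > 0" "\<not> E l i > 0"
  shows "dev k l = 0"
proof -
  interpret limit_projection UNIV "entries P" E by fact
  have "E i l > 0" using E_A_pos[of i i l] i by auto
  then have "0 \<le> dev k l" using downstream_dev_ge_0[OF P E] i by blast
  moreover have "dev (k mod p) l \<le> 0" using downstream_dev_le_0[OF P E i] p by simp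
  ultimately show ?thesis using orb_mod by simp
qed

text \<open>
  A stochastic matrix strictly decreases the variance of a non-constant function; since \<open>dev\<close> is
  periodic in time, the decrease, written as a weighted sum of squares, must vanish.
\<close>

lemma dev_arc:
  assumes P: "P \<in> subdifferential D f v" and E: "limit_projection UNIV (entries P) E"
    and i: "E i i > 0" "P $ i $ l > 0" "E l i > 0"
  shows "\<exists>\<kappa>>0. \<forall>k. dev (Suc k) i = \<kappa> * dev k l"
proof -
  interpret limit_projection UNIV "entries P" E by fact
  define u where "u j = E j i" for j
  define w where "w j = E i j" for j
  have un: "0 \<le> u j" and wn: "0 \<le> w j" for j using E_nonneg by (auto simp: u_def w_def)
  have Pn: "0 \<le> P $ j $ q" for j q using A_nonneg by simp
  \<comment> \<open>On the class of \<open>i\<close>, the entries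
    \<open>P $ j $ q * u q / u j\<close> form a stochastic matrix with invariant weights
    \<open>w j * u j\<close>; \<open>t\<close> is the deviation in this scaling and \<open>V\<close>
    its second moment. Where \<open>u j = 0\<close>, division by zero sets \<open>t\<close> to
    0.\<close>
  define t where "t k j = dev k j / u j" for k j
  define V where "V k = (\<Sum>j\<in>UNIV. w j * u j * (t k j)\<^sup>2)" for k
  define \<Delta> where "\<Delta> k = (\<Sum>j\<in>UNIV. \<Sum>q\<in>UNIV. w j * P $ j $ q * u q * (t k q - t (Suc k) j)\<^sup>2)" for k
  \<comment> \<open>If \<open>u q = 0\<close> but \<open>P $ j $ q > 0\<close>, the default
    \<open>t k q = 0\<close> is correct because \<open>downstream_dev\<close> makes the deviation
    vanish.\<close>
  have cross: "(\<Sum>q\<in>UNIV. P $ j $ q * u q * t k q) = u j * t (Suc k) j" if "w j > 0" "u j > 0" for j k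
  proof -
    have jj: "E j j > 0" using E_trans[of j i j] that by (simp add: u_def w_def)
    have pt: "P $ j $ q * u q * t k q = P $ j $ q * dev k q" for q
    proof (cases "u q = 0 \<and> P $ j $ q \<noteq> 0")
      case True
      then have "P $ j $ q > 0" using Pn[of j q] by auto
      moreover have "\<not> E q j > 0" using E_trans[of q j i] True that by (auto simp: u_def)
      ultimately have "dev k q = 0" using downstream_dev[OF P E jj] by blast
      then show ?thesis using True by simp
    qed (auto simp: t_def)
    have "(\<Sum>q\<in>UNIV. P $ j $ q * u q * t k q) = (\<Sum>q\<in>UNIV. P $ j $ q * dev k q)"
      using pt by (rule sum.cong[OF refl])
    also have "\<dots> = dev (Suc k) j"
      using dev_eq_critical[OF P E jj, of k] by (simp only: mat_app_def)
    finally have "(\<Sum>q\<in>UNIV. P $ j $ q * u q * t k q) = dev (Suc k) j" .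
    then show ?thesis using that by (simp add: t_def)
  qed
  have \<Delta>V: "\<Delta> k = V k - V (Suc k)" for k
  proof -
    have 1: "(\<Sum>j\<in>UNIV. \<Sum>q\<in>UNIV. w j * P $ j $ q * (u q * (t k q)\<^sup>2)) = V k"
    proof -
      have "(\<Sum>j\<in>UNIV. \<Sum>q\<in>UNIV. w j * P $ j $ q * (u q * (t k q)\<^sup>2))
          = (\<Sum>q\<in>UNIV. (\<Sum>j\<in>UNIV. w j * P $ j $ q) * (u q * (t k q)\<^sup>2))"
        by (subst sum.swap) (simp add: sum_distrib_right)
      then show ?thesis using EA[of i] by (simp add: V_def w_def mult.assoc)
    qed
    have 2: "(\<Sum>j\<in>UNIV. \<Sum>q\<in>UNIV. w j * t (Suc k) j * (P $ j $ q * u q * t k q)) = V (Suc k)"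
    proof -
      have "(\<Sum>q\<in>UNIV. w j * t (Suc k) j * (P $ j $ q * u q * t k q)) = w j * u j * (t (Suc k) j)\<^sup>2" for j
      proof (cases "w j > 0 \<and> u j > 0")
        case True
        have "(\<Sum>q\<in>UNIV. w j * t (Suc k) j * (P $ j $ q * u q * t k q)) = w j * t (Suc k) j * (u j * t (Suc k) j)"
          unfolding sum_distrib_left[symmetric] using cross True by simp
        then show ?thesis by (simp add: power2_eq_square)
      next
        case False
        then have "w j = 0 \<or> u j = 0" using un[of j] wn[of j] by auto
        then show ?thesis by (auto simp: t_def)
      qed
      then show ?thesis by (simp add: V_def)
    qed
    have 3: "(\<Sum>j\<in>UNIV. \<Sum>q\<in>UNIV. w j * (t (Suc k) j)\<^sup>2 * (P $ j $ q * u q)) = V (Suc k)"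
    proof -
      have "(\<Sum>q\<in>UNIV. w j * (t (Suc k) j)\<^sup>2 * (P $ j $ q * u q)) = w j * u j * (t (Suc k) j)\<^sup>2" for j
        unfolding sum_distrib_left[symmetric] using AE[of j i] by (simp add: u_def)
      then show ?thesis by (simp only: V_def)
    qed
    have "\<Delta> k = (\<Sum>j\<in>UNIV. \<Sum>q\<in>UNIV. w j * P $ j $ q * (u q * (t k q)\<^sup>2)
        - 2 * (w j * t (Suc k) j * (P $ j $ q * u q * t k q)) + w j * (t (Suc k) j)\<^sup>2 * (P $ j $ q * u q))"
      unfolding \<Delta>_def by (intro sum.cong refl) (simp add: power2_eq_square algebra_simps)
    also have "\<dots> = V k - 2 * V (Suc k) + V (Suc k)"
      unfolding sum.distrib sum_subtractf sum_distrib_left[symmetric, of 2] 1 2 3 ..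
    finally show ?thesis by simp
  qed
  have \<Delta>n: "0 \<le> \<Delta> k" for k
    unfolding \<Delta>_def using un wn Pn by (intro sum_nonneg mult_nonneg_nonneg) auto
  \<comment> \<open>\<open>V\<close> returns to its initial value after a period, so the nonnegative
    decreases \<open>\<Delta> k\<close> must all be zero.\<close>
  have "(\<Sum>k<p. \<Delta> k) = V 0 - V p"
    unfolding \<Delta>V using sum_lessThan_telescope'[of V p] by simp
  also have "V p = V 0" using orb_p by (simp add: V_def t_def)
  finally have "(\<Sum>k<p. \<Delta> k) = 0" by simp
  then have "\<forall>k\<in>{..<p}. \<Delta> k = 0" using \<Delta>n by (subst (asm) sum_nonneg_eq_0_iff) auto
  have "dev (Suc k) i = E i i / E l i * dev k l" for k
  proof -
    let ?k = "k mod p"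
    let ?g = "\<lambda>j q. w j * P $ j $ q * u q * (t ?k q - t (Suc ?k) j)\<^sup>2"
    have gn: "0 \<le> ?g j q" for j q using un wn Pn by (intro mult_nonneg_nonneg) auto
    have "(\<Sum>j\<in>UNIV. \<Sum>q\<in>UNIV. ?g j q) = 0"
      using \<open>\<forall>k\<in>{..<p}. \<Delta> k = 0\<close> p by (simp add: \<Delta>_def)
    then have "(\<Sum>q\<in>UNIV. ?g i q) = 0"
      using gn by (subst (asm) sum_nonneg_eq_0_iff) (auto intro!: sum_nonneg)
    then have "?g i l = 0" using gn by (subst (asm) sum_nonneg_eq_0_iff) auto
    then have "t ?k l = t (Suc ?k) i" using i by (simp add: w_def u_def)
    then have "dev ?k l / E l i = dev (Suc ?k) i / E i i" by (simp add: t_def u_def)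
    moreover have "orb (Suc ?k) = orb (Suc k)" using orb_mod by simp
    ultimately have "dev k l / E l i = dev (Suc k) i / E i i" using orb_mod by simp
    then show ?thesis using i by (simp add: field_simps)
  qed
  then show ?thesis using i by (intro exI[of _ "E i i / E l i"]) auto
qed

text \<open>
  Averaging the critical rows at the different times with an invariant measure as weights turns
  a critical class in space-time into critical nodes of a single subgradient at \<open>v\<close>.
\<close>

lemma critical_lift:
  assumes Q: "\<And>m. m < p \<Longrightarrow> Q m \<in> subdifferential D f (orb m)"
    and F: "limit_projection T (lift Q) F" and c: "k0 < p" "F (i0, k0) (i0, k0) > 0"
  shows "\<exists>P\<in>subdifferential D f v. \<exists>E. limit_projection UNIV (entries P) E \<and> E i0 i0 > 0"
proof -
  interpret F: limit_projection T "lift Q" F by fact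
  let ?o = "(i0, k0)"
  have \<tau>0: "?o \<in> T" using c by simp
  define K where "K = {\<tau>\<in>T. F ?o \<tau> > 0 \<and> F \<tau> ?o > 0}"
  have Qn: "0 \<le> Q m $ a $ b" if "m < p" for m a b using subdiff_nonneg[OF orb_D Q[OF that]] .
  \<comment> \<open>Equality in \<open>lift_dev\<close> on the class means that the minorant taken
    at \<open>orb (prv k)\<close> touches coordinate \<open>i\<close> of \<open>f\<close> at
    \<open>v\<close> as well.\<close>
  have row: "row_subgradient D f v i (Q (prv k) $ i)" if ik: "(i, k) \<in> K" for i k
  proof -
    have k: "k < p" "F (i, k) (i, k) > 0"
      using ik F.E_trans[of "(i, k)" ?o "(i, k)"] \<tau>0 by (auto simp: K_def)
    have eq: "mat_app T (lift Q) (\<lambda>(j, k). - dev k j) (i, k) = - dev k i"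
      using F.critical_eq'(1)[OF lift_dev[of Q, OF Q], of "(i, k)"] k by simp
    let ?m = "prv k"
    have "(\<Sum>l\<in>UNIV. Q ?m $ i $ l * (- dev ?m l)) = - dev k i" using eq lift_app[OF k(1)] by simp
    then have "Q ?m $ i \<bullet> (v - orb ?m) = v $ i - orb k $ i"
      using mat_app_matrix[of "Q ?m" "v - orb ?m" i] by (simp add: mat_app_def matrix_vector_mul_component)
    moreover have "Q ?m $ i \<bullet> (x - orb ?m) \<le> f x $ i - orb k $ i" if "x \<in> D" for x
      using Q[OF prv_less[OF k(1)]] that orb_Suc_prv[of k]
      unfolding subdifferential_iff_rows row_subgradient_def by auto
    ultimately have "Q ?m $ i \<bullet> (x - v) \<le> f x $ i - f v $ i" if "x \<in> D" for x
      using that by (fastforce simp: fv inner_diff_right)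
    then show ?thesis by (simp add: row_subgradient_def)
  qed
  \<comment> \<open>Row \<open>?o\<close> of \<open>F\<close> cut down to the class of
    \<open>?o\<close>. The cut loses no mass entering the class: a node reached from
    \<open>?o\<close> with an arc into the class belongs to it.\<close>
  define w where "w \<tau> = (if \<tau> \<in> K then F ?o \<tau> else 0)" for \<tau>
  have wn: "0 \<le> w \<tau>" for \<tau> by (auto simp: w_def K_def)
  have w: "w \<tau> \<le> (\<Sum>\<sigma>\<in>T. w \<sigma> * lift Q \<sigma> \<tau>)" if \<tau>: "\<tau> \<in> T" for \<tau>
  proof (cases "\<tau> \<in> K")
    case True
    have "F ?o \<sigma> * lift Q \<sigma> \<tau> \<le> w \<sigma> * lift Q \<sigma> \<tau>" if \<sigma>: "\<sigma> \<in> T" for \<sigma>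
    proof (cases "F ?o \<sigma> > 0 \<and> lift Q \<sigma> \<tau> > 0")
      case pos: True
      then have "F \<sigma> ?o > 0" using F.A_E_pos[OF \<sigma> \<tau> \<tau>0] True by (simp add: K_def)
      then show ?thesis using pos \<sigma> by (simp add: w_def K_def)
    next
      case False
      then have z: "F ?o \<sigma> * lift Q \<sigma> \<tau> = 0"
        using F.E_nonneg[OF \<tau>0 \<sigma>] F.A_nonneg[OF \<sigma> \<tau>] by auto
      show ?thesis unfolding z using wn F.A_nonneg[OF \<sigma> \<tau>] by (rule mult_nonneg_nonneg)
    qed
    then have "(\<Sum>\<sigma>\<in>T. F ?o \<sigma> * lift Q \<sigma> \<tau>) \<le> (\<Sum>\<sigma>\<in>T. w \<sigma> * lift Q \<sigma> \<tau>)" by (rule sum_mono)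
    then show ?thesis using F.EA[OF \<tau>0 \<tau>] True by (simp add: w_def)
  next
    case False
    then show ?thesis using wn F.A_nonneg[OF _ \<tau>] by (auto simp: w_def[of \<tau>] intro!: sum_nonneg)
  qed
  define m where "m i = (\<Sum>k<p. w (i, k))" for i
  have mn: "0 \<le> m i" for i using wn by (auto simp: m_def intro: sum_nonneg)
  obtain P0 where P0: "P0 \<in> subdifferential D f v" using subdifferential_nonempty[OF D(1) convex vD] by blast
  \<comment> \<open>Row \<open>i\<close> is a convex combination of row subgradients at
    \<open>v\<close>, weighted by \<open>w\<close> at the different times; rows without weight come
    from \<open>P0\<close>.\<close>
  define P where "P = (\<chi> i. if m i > 0 then (\<Sum>k<p. (w (i, k) / m i) *\<^sub>R Q (prv k) $ i) else P0 $ i)"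
  have P: "P \<in> subdifferential D f v"
    unfolding subdifferential_iff_rows
  proof
    fix i
    show "row_subgradient D f v i (P $ i)"
    proof (cases "m i > 0")
      case True
      have "P $ i \<bullet> (x - v) \<le> f x $ i - f v $ i" if x: "x \<in> D" for x
      proof -
        have "P $ i \<bullet> (x - v) = (\<Sum>k<p. (w (i, k) / m i) * (Q (prv k) $ i \<bullet> (x - v)))"
          using True by (simp add: P_def inner_sum_left)
        also have "\<dots> \<le> (\<Sum>k<p. (w (i, k) / m i) * (f x $ i - f v $ i))"
        proof (rule sum_mono)
          fix k
          show "(w (i, k) / m i) * (Q (prv k) $ i \<bullet> (x - v)) \<le> (w (i, k) / m i) * (f x $ i - f v $ i)"
          proof (cases "(i, k) \<in> K")
            case True
            then show ?thesis using row[OF True] x wn mn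
              by (intro mult_left_mono) (auto simp: row_subgradient_def)
          qed (simp add: w_def)
        qed
        also have "\<dots> = f x $ i - f v $ i"
          unfolding sum_distrib_right[symmetric] sum_divide_distrib[symmetric] m_def[symmetric] using True by simp
        finally show ?thesis .
      qed
      then show ?thesis by (simp add: row_subgradient_def)
    next
      case False
      then show ?thesis using P0 by (simp add: P_def subdifferential_iff_rows)
    qed
  qed
  obtain E where E: "limit_projection UNIV (entries P) E" using projection_exists[OF P] .
  interpret limit_projection UNIV "entries P" E by fact
  have mP: "m i * P $ i $ l = (\<Sum>k<p. w (i, k) * Q (prv k) $ i $ l)" for i l
  proof (cases "m i > 0")
    case True
    have "m i * P $ i $ l = (\<Sum>k<p. m i * ((w (i, k) / m i) * Q (prv k) $ i $ l))"
      using True by (simp add: P_def sum_distrib_left)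
    then show ?thesis using True by simp
  next
    case False
    then have "m i = 0" using mn[of i] by simp
    then have "w (i, k) = 0" if "k < p" for k
      using that wn unfolding m_def by (subst (asm) sum_nonneg_eq_0_iff) auto
    then show ?thesis using \<open>m i = 0\<close> by simp
  qed
  \<comment> \<open>With these weights, summing the inequality for \<open>w\<close> over all times
    becomes sub-invariance of \<open>m\<close> under \<open>P\<close>.\<close>
  have "m l \<le> (\<Sum>i\<in>UNIV. m i * P $ i $ l)" for l
  proof -
    have "m l \<le> (\<Sum>r<p. \<Sum>\<sigma>\<in>T. w \<sigma> * lift Q \<sigma> (l, r))"
      unfolding m_def using w by (intro sum_mono) auto
    also have "\<dots> = (\<Sum>i\<in>UNIV. \<Sum>k<p. \<Sum>r<p. w (i, k) * lift Q (i, k) (l, r))"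
      by (subst sum.swap) (rule sum.cartesian_product')
    also have "\<dots> = (\<Sum>i\<in>UNIV. \<Sum>k<p. w (i, k) * Q (prv k) $ i $ l)"
    proof (intro sum.cong refl)
      fix i k assume "k \<in> {..<p}"
      then have "prv k < p" using prv_less by simp
      then show "(\<Sum>r<p. w (i, k) * lift Q (i, k) (l, r)) = w (i, k) * Q (prv k) $ i $ l"
        by (simp add: lift_def if_distrib[of "\<lambda>t. _ * t"] sum.delta cong: if_cong)
    qed
    finally show ?thesis using mP by simp
  qed
  then have "m i0 \<le> (\<Sum>i\<in>UNIV. m i * E i i0)" using sub_left[of m i0] by simp
  moreover have mw: "m i \<ge> w (i, k)" if "k < p" for i k
    unfolding m_def using that wn by (intro member_le_sum) auto
  moreover have "w ?o > 0" using c by (simp add: w_def K_def)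
  ultimately have "(\<Sum>i\<in>UNIV. m i * E i i0) > 0" using c(1) by (smt (verit, best))
  then obtain l where l: "m l > 0" "E l i0 > 0" using sum_pos_obtain[of m "\<lambda>i. E i i0"] mn E_nonneg by auto
  have "\<exists>k<p. w (l, k) > 0"
  proof (rule ccontr)
    assume "\<not> ?thesis"
    then have "m l \<le> 0" unfolding m_def by (intro sum_nonpos) auto
    with l show False by simp
  qed
  then obtain k where k: "k < p" "w (l, k) > 0" by blast
  let ?\<tau> = "(l, k)"
  have \<tau>: "?\<tau> \<in> K" using k by (auto simp: w_def split: if_splits)
  have path: "(?o, ?\<tau>) \<in> {(a, b). a \<in> T \<and> b \<in> T \<and> lift Q a b > 0}\<^sup>*"
    using F.E_path[OF \<tau>0] \<tau> by (simp add: K_def)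
  \<comment> \<open>Every node on the space-time path from \<open>?o\<close> to
    \<open>?\<tau>\<close> lies in \<open>K\<close>, so its arcs project to arcs of
    \<open>P\<close>, and positivity is carried from \<open>l\<close> back to
    \<open>i0\<close>.\<close>
  have "F ?o \<sigma> > 0 \<longrightarrow> E (fst \<sigma>) i0 > 0"
    if "(\<sigma>, ?\<tau>) \<in> {(a, b). a \<in> T \<and> b \<in> T \<and> lift Q a b > 0}\<^sup>*" for \<sigma>
    using that
  proof (induction rule: converse_rtrancl_induct)
    case base
    then show ?case using l by simp
  next
    case (step \<sigma> \<rho>)
    show ?case
    proof
      assume pos: "F ?o \<sigma> > 0"
      have st: "\<sigma> \<in> T" "\<rho> \<in> T" "lift Q \<sigma> \<rho> > 0" using step.hyps(1) by auto
      have "F ?o \<rho> > 0" using F.E_A_pos[OF \<tau>0 st(1,2) pos st(3)] .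
      then have \<rho>: "E (fst \<rho>) i0 > 0" using step.IH by blast
      have "F \<sigma> ?o > 0"
        using F.A_E_pos[OF st(1,2) \<tau>0 st(3)] F.path_E_pos[OF step.hyps(2) \<tau>0] \<tau> by (simp add: K_def)
      then have "\<sigma> \<in> K" using pos st by (simp add: K_def)
      then have ws: "w \<sigma> > 0" using pos by (simp add: w_def)
      obtain a r b s where ab: "\<sigma> = (a, r)" "\<rho> = (b, s)" by (cases \<sigma>, cases \<rho>)
      have r: "r < p" "s = prv r" "Q (prv r) $ a $ b > 0"
        using st by (auto simp: ab lift_def split: if_splits)
      have ma: "m a > 0" using mw[OF r(1), of a] ws by (simp add: ab)
      have "0 < (\<Sum>k<p. w (a, k) * Q (prv k) $ a $ b)"
        using r wn Qn[OF prv_less] ws by (intro sum_pos2[of _ r]) (auto simp: ab)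
      then have "P $ a $ b > 0" using zero_less_mult_pos[OF _ ma, of "P $ a $ b"] mP[of a b] by simp
      then show "E (fst \<sigma>) i0 > 0" using A_E_pos[of a b i0] \<rho> by (simp add: ab)
    qed
  qed
  then have "E i0 i0 > 0"
    using path c by fastforce
  then show ?thesis using P E by blast
qed

end

section \<open>Periods and orders of permutations\<close>

text \<open>Periods are closed under differences and multiples, so the least positive one
  \<open>q\<close> divides every element of \<open>S\<close> and hence \<open>Gcd S\<close>;
  \<open>p\<close> guarantees that \<open>q\<close> exists.\<close>

lemma Gcd_is_period:
  fixes g :: "nat \<Rightarrow> 'a"
  assumes p: "p > 0" "\<And>k. g (k + p) = g k" and S: "\<And>n k. n \<in> S \<Longrightarrow> g (k + n) = g k"
  shows "g (k + Gcd S) = g k"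
proof -
  define Pd where "Pd = {n. \<forall>k. g (k + n) = g k}"
  have diff: "a - b \<in> Pd" if "a \<in> Pd" "b \<in> Pd" "b \<le> a" for a b
  proof -
    have "g (k + (a - b)) = g k" for k
    proof -
      have "g (k + (a - b) + b) = g (k + (a - b))" using that(2) by (simp add: Pd_def)
      moreover have "g (k + a) = g k" using that(1) by (simp add: Pd_def)
      ultimately show ?thesis using that(3) by simp
    qed
    then show ?thesis by (simp add: Pd_def)
  qed
  have mult: "q * t \<in> Pd" if "q \<in> Pd" for q t
  proof (induction t)
    case (Suc t)
    then have "g (k + q * t + q) = g k" for k using that by (simp add: Pd_def)
    then show ?case by (simp add: Pd_def algebra_simps)
  qed (simp add: Pd_def)
  define q where "q = (LEAST n. n > 0 \<and> n \<in> Pd)"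
  have "p > 0 \<and> p \<in> Pd" using p by (simp add: Pd_def)
  then have q: "q > 0 \<and> q \<in> Pd" unfolding q_def by (rule LeastI)
  have "q dvd n" if n: "n \<in> S" for n
  proof -
    have "n - q * (n div q) \<in> Pd" using n S mult[of q] q by (intro diff) (auto simp: Pd_def)
    then have "n mod q \<in> Pd" by (simp add: minus_mult_div_eq_mod)
    moreover have "n mod q < q" using q by simp
    ultimately have "n mod q = 0" using not_less_Least[of "n mod q" "\<lambda>n. n > 0 \<and> n \<in> Pd"] by (auto simp: q_def)
    then show ?thesis by auto
  qed
  then have "q dvd Gcd S" by (rule Gcd_greatest)
  then obtain t where "Gcd S = q * t" by (elim dvdE)
  then have "Gcd S \<in> Pd" using mult q by simp
  then show ?thesis by (simp add: Pd_def)
qed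

lemma funpow_cycle_of_list_eq_id_iff:
  assumes cs: "distinct cs" "cs \<noteq> []"
  shows "(cycle_of_list cs ^^ k) = id \<longleftrightarrow> length cs dvd k"
proof
  have rot: "map (cycle_of_list cs ^^ k) cs = rotate k cs" using cyclic_rotation[OF cs(1)] .
  {
    assume "(cycle_of_list cs ^^ k) = id"
    then have "rotate k cs = cs" using rot by simp
    then have "cs ! (k mod length cs) = cs ! 0"
      using nth_rotate[of 0 cs k] cs(2) by simp
    then have "k mod length cs = 0" using cs by (subst (asm) nth_eq_iff_index_eq) auto
    then show "length cs dvd k" by auto
  next
    assume "length cs dvd k"
    then have "map (cycle_of_list cs ^^ k) cs = map id cs" using rot rotate_id[of k cs] by auto
    then have "(cycle_of_list cs ^^ k) x = x" if "x \<in> set cs" for x using that unfolding map_eq_conv by auto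
    moreover have "(cycle_of_list cs ^^ k) x = x" if "x \<notin> set cs" for x
      using permutes_funpow[OF cycle_permutes] that by (rule permutes_not_in)
    ultimately show "(cycle_of_list cs ^^ k) = id" by (metis eq_id_iff)
  }
qed

text \<open>Take disjoint cycles of lengths \<open>g a\<close> on consecutive blocks; a power of the
  product is trivial iff it is trivial on each block.\<close>

lemma exists_permutation_with_Lcm_order:
  assumes "finite A" "\<And>a. a \<in> A \<Longrightarrow> g a > 0"
  shows "\<exists>\<sigma>. \<sigma> permutes {1..(\<Sum>a\<in>A. g a)} \<and> (\<forall>k. (\<sigma> ^^ k) = id \<longleftrightarrow> Lcm (g ` A) dvd k)"
  using assms
proof (induction A rule: finite_induct)
  case empty
  show ?case by (intro exI[of _ id] conjI allI permutes_id) (simp_all only: id_funpow image_empty Lcm_empty one_dvd simp_thms)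
next
  case (insert a A)
  define m where "m = (\<Sum>a\<in>A. g a)"
  obtain \<sigma> where \<sigma>: "\<sigma> permutes {1..m}" "\<And>k. (\<sigma> ^^ k) = id \<longleftrightarrow> Lcm (g ` A) dvd k"
    using insert.IH insert.prems unfolding m_def by blast
  define cs where "cs = [m + 1..<m + g a + 1]"
  have cs: "distinct cs" "cs \<noteq> []" "length cs = g a" "set cs = {m + 1..m + g a}"
    using insert.prems[of a] by (auto simp: cs_def)
  define \<tau> where "\<tau> = cycle_of_list cs"
  have \<tau>: "\<tau> permutes {m + 1..m + g a}" unfolding \<tau>_def cs(4)[symmetric] by (rule cycle_permutes)
  have \<tau>k: "(\<tau> ^^ k) = id \<longleftrightarrow> g a dvd k" for k
    unfolding \<tau>_def using funpow_cycle_of_list_eq_id_iff[OF cs(1,2)] cs(3) by simp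
  have s: "((\<sigma> \<circ> \<tau>) ^^ k) x = (\<sigma> ^^ k) x \<and> (\<tau> ^^ k) x = x" if "x \<notin> {m + 1..m + g a}" for x k
  proof -
    have "((\<sigma> \<circ> \<tau>) ^^ k) x = (\<sigma> ^^ k) x \<and> (\<sigma> ^^ k) x \<notin> {m + 1..m + g a}"
    proof (induction k)
      case (Suc k)
      let ?y = "(\<sigma> ^^ k) x"
      have "\<tau> ?y = ?y" using Suc permutes_not_in[OF \<tau>] by blast
      moreover have "\<sigma> ?y \<notin> {m + 1..m + g a}"
        using Suc permutes_in_image[OF \<sigma>(1), of ?y] permutes_not_in[OF \<sigma>(1), of ?y]
        by (cases "?y \<in> {1..m}") auto
      ultimately show ?case using Suc by simp
    qed (use that in simp)
    then show ?thesis using permutes_not_in[OF permutes_funpow[OF \<tau>] that] by simp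
  qed
  have t: "((\<sigma> \<circ> \<tau>) ^^ k) x = (\<tau> ^^ k) x \<and> (\<sigma> ^^ k) x = x" if x: "x \<in> {m + 1..m + g a}" for x k
  proof -
    have "((\<sigma> \<circ> \<tau>) ^^ k) x = (\<tau> ^^ k) x \<and> (\<tau> ^^ k) x \<in> {m + 1..m + g a}"
    proof (induction k)
      case (Suc k)
      let ?y = "(\<tau> ^^ k) x"
      have "\<tau> ?y \<in> {m + 1..m + g a}" using Suc permutes_in_image[OF \<tau>] by blast
      moreover from this have "\<sigma> (\<tau> ?y) = \<tau> ?y" by (intro permutes_not_in[OF \<sigma>(1)]) auto
      ultimately show ?case using Suc by simp
    qed (use that in simp)
    moreover have "(\<sigma> ^^ k) x = x" using x by (intro permutes_not_in[OF permutes_funpow[OF \<sigma>(1)]]) auto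
    ultimately show ?thesis by blast
  qed
  have "(\<sigma> \<circ> \<tau>) permutes {1..m + g a}"
    by (intro permutes_compose permutes_subset[OF \<sigma>(1)] permutes_subset[OF \<tau>]) auto
  moreover have "((\<sigma> \<circ> \<tau>) ^^ k) = id \<longleftrightarrow> Lcm (g ` insert a A) dvd k" for k
  proof -
    have "((\<sigma> \<circ> \<tau>) ^^ k) = id \<longleftrightarrow> (\<sigma> ^^ k) = id \<and> (\<tau> ^^ k) = id"
    proof
      assume *: "((\<sigma> \<circ> \<tau>) ^^ k) = id"
      have "(\<sigma> ^^ k) x = id x" "(\<tau> ^^ k) x = id x" for x
        using s[of x k] t[of x k] fun_cong[OF *, of x] by (cases "x \<in> {m + 1..m + g a}"; simp)+
      then show "(\<sigma> ^^ k) = id \<and> (\<tau> ^^ k) = id" by blast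
    next
      assume *: "(\<sigma> ^^ k) = id \<and> (\<tau> ^^ k) = id"
      have "((\<sigma> \<circ> \<tau>) ^^ k) x = id x" for x
        using s[of x k] t[of x k] * by (cases "x \<in> {m + 1..m + g a}") auto
      then show "((\<sigma> \<circ> \<tau>) ^^ k) = id" by blast
    qed
    then show ?thesis by (auto simp: \<sigma>(2) \<tau>k)
  qed
  moreover have "(\<Sum>a\<in>insert a A. g a) = m + g a" using insert.hyps by (simp add: m_def)
  ultimately show ?case by metis
qed

text \<open>A divisor \<open>d\<close> of the order is realised by raising the product of cycles to
  the cofactor \<open>r\<close>.\<close>

lemma exists_sym_group_element_of_order:
  assumes A: "finite A" "\<And>a. a \<in> A \<Longrightarrow> g a > 0" and le: "(\<Sum>a\<in>A. g a) \<le> n"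
    and d: "d dvd Lcm (g ` A)"
  shows "\<exists>\<sigma>\<in>carrier (sym_group n). group.ord (sym_group n) \<sigma> = d"
proof -
  interpret S: group "sym_group n" by (rule sym_group_is_group)
  obtain \<sigma> where \<sigma>: "\<sigma> permutes {1..(\<Sum>a\<in>A. g a)}" "\<And>k. (\<sigma> ^^ k) = id \<longleftrightarrow> Lcm (g ` A) dvd k"
    using exists_permutation_with_Lcm_order[of A g, OF A] by blast
  have \<sigma>S: "\<sigma> \<in> carrier (sym_group n)"
    unfolding sym_group_carrier using permutes_subset[OF \<sigma>(1), of "{1..n}"] le by auto
  have pow: "\<sigma> [^]\<^bsub>sym_group n\<^esub> k = \<sigma> ^^ k" for k :: nat
  proof (induction k)
    case (Suc k)
    then show ?case by (simp add: sym_group_mult funpow_swap1 fun_eq_iff)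
  qed (simp add: sym_group_one)
  have L: "S.ord \<sigma> = Lcm (g ` A)"
    using S.ord_unique[OF \<sigma>S] \<sigma>(2) pow by (simp add: sym_group_one)
  have "Lcm (g ` A) \<noteq> 0" using A by (subst Lcm_0_iff) force+
  define r where "r = Lcm (g ` A) div d"
  have r: "r \<noteq> 0" "r dvd Lcm (g ` A)" "Lcm (g ` A) div r = d"
    using d \<open>Lcm (g ` A) \<noteq> 0\<close> by (auto simp: r_def elim!: dvdE)
  have "S.ord (\<sigma> [^]\<^bsub>sym_group n\<^esub> r) = d" using S.ord_pow[OF \<sigma>S, of r] r L by simp
  then show ?thesis using S.nat_pow_closed[OF \<sigma>S] by blast
qed

section \<open>Circuits of the critical graph\<close>

context convex_monotone_periodic
begin

abbreviation G :: "('n, 'n \<times> 'n) pre_digraph" where "G \<equiv> critical_graph D f v"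

lemma verts_G: "verts G = (\<Union>P\<in>subdifferential D f v. critical_nodes P)"
  by (simp add: critical_graph_def matrix_critical_graph_def)

lemma arcs_G: "arcs G = {(i, j). \<exists>P\<in>subdifferential D f v. P $ i $ j > 0 \<and> i \<in> critical_nodes P \<and> j \<in> critical_nodes P}"
  by (auto simp: critical_graph_def matrix_critical_graph_def matrix_digraph_def)

lemma tail_G: "tail G = fst" and head_G: "head G = snd"
  by (simp_all add: critical_graph_def)

lemma fin_digraph_G: "fin_digraph G"
  by unfold_locales (auto simp: verts_G arcs_G tail_G head_G)

text \<open>The head of the arc is critical for the same \<open>P\<close>, so
  \<open>critical_link_symmetric\<close> provides the way back that \<open>dev_arc\<close>
  requires.\<close>

lemma dev_critical_arc:
  assumes "(i, j) \<in> arcs G"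
  shows "\<exists>\<kappa>>0. \<forall>k. dev (Suc k) i = \<kappa> * dev k j"
proof -
  obtain P where P: "P \<in> subdifferential D f v" "P $ i $ j > 0" "i \<in> critical_nodes P" "j \<in> critical_nodes P"
    using assms by (auto simp: arcs_G)
  obtain E where E: "limit_projection UNIV (entries P) E" using projection_exists[OF P(1)] .
  interpret limit_projection UNIV "entries P" E by fact
  have ij: "E i i > 0" "E j j > 0" using P(3,4) critical_nodes_iff[OF E] by auto
  then have "E i j > 0" using E_A_pos[of i i j] P(2) by simp
  then have "E j i > 0" using critical_link_symmetric[of i j] ij by simp
  then show ?thesis using dev_arc[OF P(1) E ij(1) P(2)] by blast
qed

interpretation G: fin_digraph G by (rule fin_digraph_G)

lemma dev_awalk:
  assumes "G.awalk u c w"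
  shows "\<exists>\<kappa>>0. \<forall>k. dev (k + length c) u = \<kappa> * dev k w"
  using assms
proof (induction c arbitrary: u)
  case Nil
  then have "u = w" by (simp add: G.awalk_Nil_iff)
  then show ?case by (intro exI[of _ 1]) simp
next
  case (Cons e c)
  then have e: "e \<in> arcs G" "tail G e = u" "G.awalk (head G e) c w" by (auto simp: G.awalk_Cons_iff)
  then have arc: "(u, head G e) \<in> arcs G" by (cases e) (simp add: tail_G head_G)
  obtain \<kappa> where \<kappa>: "\<kappa> > 0" "\<And>k. dev (k + length c) (head G e) = \<kappa> * dev k w" using Cons.IH[OF e(3)] by blast
  obtain \<mu> where \<mu>: "\<mu> > 0" "\<And>k. dev (Suc k) u = \<mu> * dev k (head G e)" using dev_critical_arc[OF arc] by blast
  have "dev (k + length (e # c)) u = (\<mu> * \<kappa>) * dev k w" for k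
    using \<mu>(2)[of "k + length c"] \<kappa>(2)[of k] by simp
  then show ?case using \<kappa>(1) \<mu>(1) by (intro exI[of _ "\<mu> * \<kappa>"]) (simp only: mult_pos_pos simp_thms)
qed

lemma orb_add_mult: "orb (k + p * t) = orb k"
  by (metis mod_mult_self2 orb_mod)

text \<open>Going round \<open>p\<close> times shifts time by a multiple of \<open>p\<close>, so the
  factor \<open>\<kappa> ^ p\<close> leaves the deviation unchanged; as \<open>\<kappa> > 0\<close>,
  it is 1 or the deviation is zero.\<close>

lemma dev_circuit:
  assumes "G.awalk u c u"
  shows "dev (k + length c) u = dev k u"
proof -
  obtain \<kappa> where \<kappa>: "\<kappa> > 0" "\<And>k. dev (k + length c) u = \<kappa> * dev k u" using dev_awalk[OF assms] by blast
  have "dev (k + length c * t) u = \<kappa> ^ t * dev k u" for t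
  proof (induction t)
    case (Suc t)
    have "k + length c * Suc t = (k + length c * t) + length c" by simp
    then show ?case using Suc \<kappa>(2)[of "k + length c * t"] by (simp only: power_Suc mult.assoc)
  qed simp
  from this[of p] have "\<kappa> ^ p * dev k u = dev k u"
    using orb_add_mult[of k "length c"] by (simp add: mult.commute)
  then have "\<kappa> = 1 \<or> dev k u = 0"
    using \<kappa>(1) p power_eq_1_iff[of \<kappa> p] by auto
  then show ?thesis using \<kappa>(2)[of k] by auto
qed

text \<open>A walk from \<open>i\<close> to \<open>u\<close> makes the deviations proportional up to
  a time shift, so every circuit length at \<open>u\<close> is a period at \<open>i\<close>, and
  \<open>Gcd_is_period\<close> passes to the gcd.\<close>

lemma scc_period:
  assumes H: "H \<in> G.sccs" and i: "i \<in> verts H"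
  shows "dev (k + cyclicity_scc H) i = dev k i"
  unfolding cyclicity_scc_def
proof (rule Gcd_is_period[OF p])
  show "dev (k + p) i = dev k i" for k using orb_add_mult[of k 1] by simp
next
  fix n k assume "n \<in> {length c |u c. pre_digraph.awalk H u c u \<and> c \<noteq> []}"
  then obtain u c where c: "n = length c" "pre_digraph.awalk H u c u" by blast
  have ind: "induced_subgraph H G" and sc: "strongly_connected H" using H by (auto simp: G.in_sccsE)
  have sub: "subgraph H G" using ind by (rule induced_imp_subgraph)
  then interpret H: wf_digraph H by (auto simp: subgraph_def)
  have cG: "G.awalk u c u" using G.subgraph_awalk_imp_awalk[OF c(2) sub] .
  have "u \<in> verts H" using c(2) by (auto simp: H.awalk_def)
  then have "i \<rightarrow>\<^sup>*\<^bsub>H\<^esub> u" using sc i by (auto simp: strongly_connected_def)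
  then obtain a where "H.awalk i a u" using H.reachable_awalk by blast
  then have "G.awalk i a u" using G.subgraph_awalk_imp_awalk sub by blast
  then obtain \<kappa> where \<kappa>: "\<kappa> > 0" "\<And>k. dev (k + length a) i = \<kappa> * dev k u" using dev_awalk by blast
  obtain p' where p': "p = Suc p'" using p by (cases p) auto
  \<comment> \<open>Together with \<open>length a\<close> the added \<open>length a * p'\<close> is
    a multiple of \<open>p\<close>, which cancels the time shift of the walk.\<close>
  let ?k = "k + length a * p'"
  have "dev (?k + n + length a) i = dev (?k + length a) i"
    using \<kappa>(2)[of "?k + n"] \<kappa>(2)[of ?k] dev_circuit[OF cG, of ?k] c(1) by simp
  moreover have "?k + n + length a = (k + n) + p * length a" "?k + length a = k + p * length a"
    by (simp_all add: p' algebra_simps)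
  ultimately show "dev (k + n) i = dev k i" by (simp only: orb_add_mult)
qed

lemma critical_orb_shift:
  assumes "i \<in> verts G"
  shows "orb (k + cyclicity G) $ i = orb k $ i"
proof -
  have "G.scc_of i \<in> G.sccs_verts" using assms by (rule G.scc_of_in_sccs_verts)
  then obtain H where H: "H \<in> G.sccs" "verts H = G.scc_of i" by (auto simp: G.sccs_verts_conv)
  have i: "i \<in> verts H" using G.in_scc_of_self[OF assms] H by simp
  have "cyclicity_scc H dvd cyclicity G" unfolding cyclicity_def using H(1) by (intro dvd_Lcm imageI)
  then obtain t where t: "cyclicity G = cyclicity_scc H * t" by (elim dvdE)
  have "dev (k + cyclicity_scc H * t) i = dev k i" for t
  proof (induction t)
    case (Suc t)
    have "k + cyclicity_scc H * Suc t = (k + cyclicity_scc H * t) + cyclicity_scc H" by simp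
    then show ?case using Suc scc_period[OF H(1) i, of "k + cyclicity_scc H * t"] by (simp only:)
  qed simp
  then show ?thesis using t by simp
qed

theorem orb_cyclicity: "orb (cyclicity G) = \<xi>"
proof -
  let ?c = "cyclicity G"
  have "\<exists>Q. Q \<in> subdifferential D f (orb m)" for m
    using subdifferential_nonempty[OF D(1) convex orb_D] .
  then obtain Q where Q: "\<And>m. Q m \<in> subdifferential D f (orb m)" by metis
  obtain F where F: "limit_projection T (lift Q) F" using lift_projection_exists[of Q, OF Q] .
  interpret F: limit_projection T "lift Q" F by fact
  define x where "x = (\<lambda>(j, k). orb k $ j - orb (k + ?c) $ j)"
  have le: "x \<tau> \<le> 0" if \<tau>: "\<tau> \<in> T" for \<tau>
  proof (rule F.nonpos_from_critical[OF _ _ \<tau>])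
    show "x \<sigma> \<le> mat_app T (lift Q) x \<sigma>" if "\<sigma> \<in> T" for \<sigma>
      using lift_shift[of Q, OF Q that, of ?c] by (simp add: x_def)
    fix \<sigma> assume \<sigma>: "\<sigma> \<in> T" "F \<sigma> \<sigma> > 0"
    obtain i k where ik: "\<sigma> = (i, k)" "k < p" using \<sigma>(1) by auto
    obtain P E where P: "P \<in> subdifferential D f v" "limit_projection UNIV (entries P) E" "E i i > 0"
      using critical_lift[of Q, OF Q F ik(2), of i] \<sigma>(2) ik by blast
    then have "i \<in> verts G" using critical_nodes_iff[OF P(2)] by (auto simp: verts_G)
    then show "x \<sigma> \<le> 0" using critical_orb_shift[of i k] by (simp add: x_def ik)
  qed
  have step: "orb k \<le> orb (k + ?c)" for k
  proof -
    have "orb (k mod p) \<le> orb (k mod p + ?c)"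
      unfolding vec_le_iff using le[of "(_, k mod p)"] p by (auto simp: x_def)
    also have "orb (k mod p + ?c) = orb (k + ?c)"
      by (metis orb_mod mod_add_left_eq)
    finally show ?thesis using orb_mod by simp
  qed
  have chain: "orb k \<le> orb (k + ?c * t)" for k t
  proof (induction t)
    case (Suc t)
    also have "orb (k + ?c * t) \<le> orb (k + ?c * t + ?c)" by (rule step)
    finally show ?case by (simp add: algebra_simps)
  qed simp
  obtain p' where p': "p = Suc p'" using p by (cases p) auto
  \<comment> \<open>After \<open>p'\<close> further shifts the orbit has moved \<open>p * ?c\<close>
    steps and is back at \<open>\<xi>\<close>, so the increasing chain closes up.\<close>
  have "orb ?c \<le> orb (?c + ?c * p')" by (rule chain)
  also have "?c + ?c * p' = 0 + p * ?c" using p' by simp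
  also have "orb (0 + p * ?c) = \<xi>" unfolding orb_add_mult by simp
  finally have "orb ?c \<le> \<xi>" .
  moreover have "\<xi> \<le> orb ?c" using step[of 0] by simp
  ultimately show ?thesis by (rule antisym)
qed

section \<open>Size of the cyclicities of the components\<close>

text \<open>Ensures positive cyclicities: a component without circuits would get the gcd of the
  empty set, 0. \<open>E u u > 0\<close> yields an arc from \<open>u\<close> and a way back whose
  nodes stay in the class of \<open>u\<close> for one \<open>P\<close>, hence in the critical
  graph.\<close>

lemma critical_out_arc:
  assumes "u \<in> verts G"
  shows "\<exists>l. (u, l) \<in> arcs G \<and> l \<rightarrow>\<^sup>*\<^bsub>G\<^esub> u"
proof -
  obtain P where P: "P \<in> subdifferential D f v" "u \<in> critical_nodes P" using assms by (auto simp: verts_G)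
  obtain E where E: "limit_projection UNIV (entries P) E" using projection_exists[OF P(1)] .
  interpret limit_projection UNIV "entries P" E by fact
  have u: "E u u > 0" using P(2) critical_nodes_iff[OF E] by simp
  have arc: "(a, b) \<in> arcs G" if "E u a > 0" "E a u > 0" "P $ a $ b > 0" "E b u > 0" for a b
  proof -
    have "E u b > 0" using E_A_pos[of u a b] that by simp
    then have "E a a > 0" "E b b > 0" using E_trans[of a u a] E_trans[of b u b] that by auto
    then show ?thesis using critical_nodes_iff[OF E] that P(1) by (auto simp: arcs_G)
  qed
  have "(\<Sum>l\<in>UNIV. P $ u $ l * E l u) > 0" using AE[of u u] u by simp
  then obtain l where l: "P $ u $ l > 0" "E l u > 0"
    using sum_pos_obtain[of "\<lambda>l. P $ u $ l" "\<lambda>l. E l u"] A_nonneg E_nonneg by auto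
  have ul: "(u, l) \<in> arcs G" using arc u l by simp
  have "(l, u) \<in> {(a, b). a \<in> UNIV \<and> b \<in> UNIV \<and> P $ a $ b > 0}\<^sup>*" using E_path[of l u] l by simp
  then have "E u l > 0 \<longrightarrow> l \<rightarrow>\<^sup>*\<^bsub>G\<^esub> u"
  proof (induction rule: converse_rtrancl_induct)
    case base
    show ?case using assms by simp
  next
    case (step a b)
    show ?case
    proof
      assume a: "E u a > 0"
      have ab: "P $ a $ b > 0" using step.hyps(1) by simp
      have b: "E u b > 0" "E b u > 0" using E_A_pos[of u a b] a ab path_E_pos[OF step.hyps(2), of u] u by auto
      then have "E a u > 0" using A_E_pos[of a b u] ab by simp
      then have "(a, b) \<in> arcs G" using arc a ab b by blast
      then have "a \<rightarrow>\<^bsub>G\<^esub> b" using G.in_arcs_imp_in_arcs_ends[of "(a, b)"] by (simp add: tail_G head_G)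
      then show "a \<rightarrow>\<^sup>*\<^bsub>G\<^esub> u" using step.IH b(1) G.adj_reachable_trans by blast
    qed
  qed
  moreover have "E u l > 0" using E_A_pos[of u u l] u l by simp
  ultimately show ?thesis using ul by blast
qed

text \<open>An arc from \<open>u\<close> followed by an elementary path back is a circuit with at
  most as many arcs as there are vertices, and the gcd divides its length.\<close>

lemma scc_cyclicity_bounds:
  assumes H: "H \<in> G.sccs"
  shows "0 < cyclicity_scc H" "cyclicity_scc H \<le> card (verts H)"
proof -
  have ind: "induced_subgraph H G" and sc: "strongly_connected H" using H by (auto simp: G.in_sccsE)
  have sub: "subgraph H G" using ind by (rule induced_imp_subgraph)
  then interpret H: wf_digraph H by (auto simp: subgraph_def)
  have th: "tail H = tail G" "head H = head G" using sub by (auto simp: subgraph_def compatible_def)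
  interpret H: fin_digraph H by (rule G.fin_digraph_subgraph[OF sub])
  obtain u where u: "u \<in> verts H" using sc by (auto simp: strongly_connected_def)
  then have "u \<in> verts G" using sub by (auto simp: subgraph_def)
  then obtain l where l: "(u, l) \<in> arcs G" "l \<rightarrow>\<^sup>*\<^bsub>G\<^esub> u" using critical_out_arc by blast
  have "u \<rightarrow>\<^bsub>G\<^esub> l" using G.in_arcs_imp_in_arcs_ends[OF l(1)] by (simp add: tail_G head_G)
  then have "u \<rightarrow>\<^sup>*\<^bsub>G\<^esub> l" by (rule G.reachable_adjI)
  moreover have "verts H \<in> G.sccs_verts" using H by (auto simp: G.sccs_verts_conv)
  ultimately have lH: "l \<in> verts H" using u l(2) unfolding G.in_sccs_verts_conv_reachable by blast
  have ulH: "(u, l) \<in> arcs H" using ind l(1) u lH by (auto simp: induced_subgraph_def tail_G head_G)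
  have "l \<rightarrow>\<^sup>*\<^bsub>H\<^esub> u" using sc u lH by (auto simp: strongly_connected_def)
  then obtain a where a: "H.apath l a u" using H.reachable_apath by blast
  then have "H.awalk l a u" by (rule H.awalkI_apath)
  then have "H.awalk u ((u, l) # a) u" using ulH u by (simp add: H.awalk_Cons_iff th tail_G head_G)
  then have "length ((u, l) # a) \<in> {length c |u c. H.awalk u c u \<and> c \<noteq> []}" by blast
  then have dvd: "cyclicity_scc H dvd length ((u, l) # a)" unfolding cyclicity_scc_def by (rule Gcd_dvd)
  then show "0 < cyclicity_scc H" by (intro dvd_pos_nat[OF _ dvd]) simp
  have "cyclicity_scc H \<le> length ((u, l) # a)" using dvd by (intro dvd_imp_le) auto
  also have "\<dots> \<le> card (verts H)" using H.length_apath_less[OF a] by simp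
  finally show "cyclicity_scc H \<le> card (verts H)" .
qed

lemma finite_sccs_G: "finite G.sccs"
  using G.finite_sccs_verts G.inj_on_verts_sccs unfolding G.sccs_verts_conv by (rule finite_imageD)

lemma sum_cyclicity_le: "(\<Sum>H\<in>G.sccs. cyclicity_scc H) \<le> CARD('n)"
proof -
  have "(\<Sum>H\<in>G.sccs. cyclicity_scc H) \<le> (\<Sum>H\<in>G.sccs. card (verts H))"
    using scc_cyclicity_bounds by (intro sum_mono) auto
  also have "\<dots> = card (\<Union>H\<in>G.sccs. verts H)"
    using finite_sccs_G G.scc_disj by (intro card_UN_disjoint[symmetric]) auto
  also have "\<dots> \<le> CARD('n)" by (intro card_mono) auto
  finally show ?thesis .
qed

lemma dvd_cyclicity_order:
  assumes "d dvd cyclicity G"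
  shows "\<exists>\<sigma>\<in>carrier (sym_group CARD('n)). group.ord (sym_group CARD('n)) \<sigma> = d"
  using exists_sym_group_element_of_order[OF finite_sccs_G _ sum_cyclicity_le] scc_cyclicity_bounds(1) assms
  unfolding cyclicity_def by blast

end

theorem theorem8p6:
  fixes D :: "(real^'n) set" and f :: "real^'n \<Rightarrow> real^'n" and v :: "real^'n"
  assumes "open D" and "convex D" and "downward D"
    and "f \<in> D \<rightarrow> D"
    and "convex_map_on D f" and "mono_on D f"
    and "t_stable_fixed_point D f v"
  shows "(\<forall>\<xi> p. t_stable_periodic_point D f \<xi> p \<longrightarrow> p dvd cyclicity (critical_graph D f v)) \<and>
         (\<forall>\<xi> p. t_stable_periodic_point D f \<xi> p \<longrightarrow>
            (\<exists>\<sigma>\<in>carrier (sym_group CARD('n)). group.ord (sym_group CARD('n)) \<sigma> = p))"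
proof -
  have "p dvd cyclicity (critical_graph D f v) \<and>
      (\<exists>\<sigma>\<in>carrier (sym_group CARD('n)). group.ord (sym_group CARD('n)) \<sigma> = p)"
    if "t_stable_periodic_point D f \<xi> p" for \<xi> p
  proof -
    have per: "has_period f \<xi> p" and ts: "t_stable_fixed_point D (f ^^ p) \<xi>"
      using that by (auto simp: t_stable_periodic_point_def)
    have p: "p > 0" and minimal: "\<And>q. 0 < q \<Longrightarrow> q < p \<Longrightarrow> (f ^^ q) \<xi> \<noteq> \<xi>"
      using per by (auto simp: has_period_def)
    interpret convex_monotone_periodic D f v \<xi> p
      by unfold_locales (fact assms p ts)+
    let ?c = "cyclicity (critical_graph D f v)"
    have "(f ^^ (?c mod p)) \<xi> = \<xi>" using orb_cyclicity orb_mod by simp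
    then have "?c mod p = 0" using minimal[of "?c mod p"] p by (cases "?c mod p = 0") auto
    then have "p dvd ?c" by auto
    then show ?thesis using dvd_cyclicity_order by blast
  qed
  then show ?thesis by blast
qed

end
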